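(* Let $m,n$ be coprime positive integers and $G=\langle x,y\mid x^m=y^n\rangle$. Let $Y_{irr}$ be the set of characters of irreducible $SU(2)$-representations of $G$, regarded inside the $SL(2,\mathbb{C})$-character variety of $G$. Then there is an isomorphism $$Y_{irr}\cong\{(\lambda,\mu,r):\lambda^m=\mu^n=\pm1;\ \lambda,\mu\neq\pm1;\ r\in(-\infty,0)\}/(\mathbb{Z}_2\times\mathbb{Z}_2),$$ where $\lambda,\mu\in\mathbb{C}$, the condition $\lambda^m=\mu^n=\pm1$ means that $\lambda^m=\mu^n$ and this common value is $1$ or $-1$, and the two generators of $\mathbb{Z}_2\times\mathbb{Z}_2$ act by $(\lambda,\mu,r)\mapsto(\lambda^{-1},\mu,r^{-1})$ and $(\lambda,\mu,r)\mapsto(\lambda,\mu^{-1},r^{-1})$. This real algebraic variety consists of $\frac{(m-1)(n-1)}{2}$ open intervals.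
   Context: $G$ is the fundamental group of the complement in $S^3$ of the torus knot of type $(m,n)$. An $SU(2)$-representation of $G$ is a homomorphism $\rho:G\to SU(2)$; equivalently, a pair $(A,B)=(\rho(x),\rho(y))$ of matrices in $SU(2)$ with $A^m=B^n$. It is irreducible if $A$ and $B$ have no common eigenvector in $\mathbb{C}^2$. The character of a representation $\rho$ is the map $\chi_\rho:G\to\mathbb{C}$, $\chi_\rho(g)=\operatorname{tr}\rho(g)$. The $SL(2,\mathbb{C})$-character variety of $G$ is the set of characters of all homomorphisms $G\to SL(2,\mathbb{C})$, which can be endowed with the structure of an algebraic variety; characters of $SU(2)$-representations lie in it via the inclusion $SU(2)\subset SL(2,\mathbb{C})$. The triple $(\lambda,\mu,r)$ arises from an irreducible $SU(2)$-pair $(A,B)$ as follows: $\lambda,\lambda^{-1}$ are the eigenvalues of $A$ with eigenlines $e_1,e_2\in\mathbb{P}^1$ respectively, $\mu,\mu^{-1}$ are the eigenvalues of $B$ with eigenlines $f_1,f_2\in\mathbb{P}^1$ respectively, and $r=[e_1,e_2,f_1,f_2]$ is the cross ratio, normalized so that $[0,\infty,p,q]=p/q$. Exchanging $e_1,e_2$ (respectively $f_1,f_2$) gives the first (respectively second) generator of the $\mathbb{Z}_2\times\mathbb{Z}_2$-action. *)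

theory Defs
  imports
    "HOL-Analysis.Analysis"
    "HOL-Algebra.Group_Action"
    "HOL-Algebra.Elementary_Groups"
begin

section \<open>Groups given by generators and relations\<close>

text \<open>
  A letter \<open>(a, True)\<close> stands for the generator \<open>a\<close> and \<open>(a, False)\<close> for its inverse.
  The presented group consists of the words modulo the least congruence for concatenation
  that contains the free cancellations and the given relations.
\<close>

type_synonym 'g gword = "('g \<times> bool) list"

inductive pres_eq :: "('g gword \<times> 'g gword) set \<Rightarrow> 'g gword \<Rightarrow> 'g gword \<Rightarrow> bool"
  for R where
  pres_refl: "pres_eq R u u"
| pres_sym: "pres_eq R u v \<Longrightarrow> pres_eq R v u"
| pres_trans: "pres_eq R u v \<Longrightarrow> pres_eq R v w \<Longrightarrow> pres_eq R u w"
| pres_append: "pres_eq R u u' \<Longrightarrow> pres_eq R v v' \<Longrightarrow> pres_eq R (u @ v) (u' @ v')"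
| pres_cancel: "pres_eq R [(a, b), (a, \<not> b)] []"
| pres_rel: "(u, v) \<in> R \<Longrightarrow> pres_eq R u v"

definition word_class :: "('g gword \<times> 'g gword) set \<Rightarrow> 'g gword \<Rightarrow> 'g gword set" where
  "word_class R u = {v. pres_eq R u v}"

definition presented_group :: "('g gword \<times> 'g gword) set \<Rightarrow> 'g gword set monoid" where
  "presented_group R =
    \<lparr>carrier = range (word_class R),
     monoid.mult = (\<lambda>U V. \<Union>u\<in>U. \<Union>v\<in>V. word_class R (u @ v)),
     one = word_class R []\<rparr>"

lemma word_class_eq_iff: "word_class R u = word_class R v \<longleftrightarrow> pres_eq R u v"
proof
  assume "word_class R u = word_class R v"
  then have "v \<in> word_class R u"
    by (simp add: word_class_def pres_refl)
  then show "pres_eq R u v"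
    by (simp add: word_class_def)
next
  assume uv: "pres_eq R u v"
  show "word_class R u = word_class R v"
    unfolding word_class_def
    using pres_trans[OF uv] pres_trans[OF pres_sym[OF uv]] by blast
qed

lemma presented_group_mult:
  "word_class R u \<otimes>\<^bsub>presented_group R\<^esub> word_class R v = word_class R (u @ v)"
proof -
  have *: "word_class R (u' @ v') = word_class R (u @ v)"
    if "u' \<in> word_class R u" "v' \<in> word_class R v" for u' v'
    using that unfolding word_class_eq_iff word_class_def[of R u] word_class_def[of R v] mem_Collect_eq
    by (intro pres_sym[OF pres_append])
  have mem: "u \<in> word_class R u" "v \<in> word_class R v"
    by (simp_all add: word_class_def pres_refl)
  have "(\<Union>u'\<in>word_class R u. \<Union>v'\<in>word_class R v. word_class R (u' @ v')) =
      (\<Union>u'\<in>word_class R u. \<Union>v'\<in>word_class R v. word_class R (u @ v))"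
    by (intro SUP_cong refl *)
  also have "\<dots> = word_class R (u @ v)"
    using mem by blast
  finally show ?thesis
    by (simp add: presented_group_def)
qed

lemma pres_eq_inverse: "pres_eq R (map (\<lambda>(a, b). (a, \<not> b)) (rev u) @ u) []"
proof (induction u)
  case Nil
  show ?case by (simp add: pres_refl)
next
  case (Cons l u)
  obtain a b where l: "l = (a, b)" by (cases l)
  let ?i = "map (\<lambda>(a, b). (a, \<not> b)) (rev u)"
  have "pres_eq R [(a, \<not> b), (a, b)] []"
    using pres_cancel[of R a "\<not> b"] by simp
  then have "pres_eq R (?i @ [(a, \<not> b), (a, b)] @ u) (?i @ [] @ u)"
    by (intro pres_append pres_refl)
  then have "pres_eq R (map (\<lambda>(a, b). (a, \<not> b)) (rev (l # u)) @ l # u) (?i @ u)"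
    by (simp add: l)
  then show ?case
    by (rule pres_trans[OF _ Cons.IH])
qed

lemma group_presented_group: "group (presented_group R)"
proof (rule groupI)
  fix U assume "U \<in> carrier (presented_group R)"
  then obtain u where u: "U = word_class R u"
    by (auto simp: presented_group_def)
  have one: "\<one>\<^bsub>presented_group R\<^esub> = word_class R []"
    by (simp add: presented_group_def)
  show "\<exists>V\<in>carrier (presented_group R). V \<otimes>\<^bsub>presented_group R\<^esub> U = \<one>\<^bsub>presented_group R\<^esub>"
    by (rule bexI[of _ "word_class R (map (\<lambda>(a, b). (a, \<not> b)) (rev u))"])
      (simp_all only: u one presented_group_mult word_class_eq_iff pres_eq_inverse,
       simp add: presented_group_def)
  show "\<one>\<^bsub>presented_group R\<^esub> \<otimes>\<^bsub>presented_group R\<^esub> U = U"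
    by (simp add: u one presented_group_mult)
next
  fix U V assume "U \<in> carrier (presented_group R)" "V \<in> carrier (presented_group R)"
  then obtain u v where uv: "U = word_class R u" "V = word_class R v"
    by (auto simp: presented_group_def)
  show "U \<otimes>\<^bsub>presented_group R\<^esub> V \<in> carrier (presented_group R)"
    unfolding uv presented_group_mult by (simp add: presented_group_def)
  fix W assume "W \<in> carrier (presented_group R)"
  then obtain w where w: "W = word_class R w"
    by (auto simp: presented_group_def)
  show "U \<otimes>\<^bsub>presented_group R\<^esub> V \<otimes>\<^bsub>presented_group R\<^esub> W =
        U \<otimes>\<^bsub>presented_group R\<^esub> (V \<otimes>\<^bsub>presented_group R\<^esub> W)"
    by (simp add: uv w presented_group_mult)
qed (simp add: presented_group_def)

datatype torus_gen = Gen_x | Gen_y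

definition torus_rels :: "nat \<Rightarrow> nat \<Rightarrow> (torus_gen gword \<times> torus_gen gword) set" where
  "torus_rels m n = {(replicate m (Gen_x, True), replicate n (Gen_y, True))}"

definition torus_knot_group :: "nat \<Rightarrow> nat \<Rightarrow> torus_gen gword set monoid" where
  "torus_knot_group m n = presented_group (torus_rels m n)"

definition tk_x :: "nat \<Rightarrow> nat \<Rightarrow> torus_gen gword set" where
  "tk_x m n = word_class (torus_rels m n) [(Gen_x, True)]"

definition tk_y :: "nat \<Rightarrow> nat \<Rightarrow> torus_gen gword set" where
  "tk_y m n = word_class (torus_rels m n) [(Gen_y, True)]"

section \<open>Representations and characters\<close>

definition conj_transpose :: "complex^'n^'m \<Rightarrow> complex^'m^'n" where
  "conj_transpose A = (\<chi> i j. cnj (A $ j $ i))"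

definition SL2C :: "(complex^2^2) monoid" where
  "SL2C = \<lparr>carrier = {A. det A = 1}, monoid.mult = (**), one = mat 1\<rparr>"

definition SU2 :: "(complex^2^2) monoid" where
  "SU2 = \<lparr>carrier = {A. A ** conj_transpose A = mat 1 \<and> det A = 1},
          monoid.mult = (**), one = mat 1\<rparr>"

definition has_eigenvector :: "complex^'n^'n \<Rightarrow> complex \<Rightarrow> complex^'n \<Rightarrow> bool" where
  "has_eigenvector A c v \<longleftrightarrow> v \<noteq> 0 \<and> A *v v = c *s v"

definition irreducible_pair :: "complex^2^2 \<Rightarrow> complex^2^2 \<Rightarrow> bool" where
  "irreducible_pair A B \<longleftrightarrow> \<not> (\<exists>v c d. has_eigenvector A c v \<and> has_eigenvector B d v)"

definition irred_SU2_reps :: "nat \<Rightarrow> nat \<Rightarrow> (torus_gen gword set \<Rightarrow> complex^2^2) set" where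
  "irred_SU2_reps m n =
    {\<rho> \<in> hom (torus_knot_group m n) SU2. irreducible_pair (\<rho> (tk_x m n)) (\<rho> (tk_y m n))}"

text \<open>
  Restricting to the carrier makes characters extensional, so that equality of functions
  is equality of characters.
\<close>

definition rep_character :: "('g, 'b) monoid_scheme \<Rightarrow> ('g \<Rightarrow> complex^2^2) \<Rightarrow> 'g \<Rightarrow> complex" where
  "rep_character G \<rho> = (\<lambda>g\<in>carrier G. trace (\<rho> g))"

definition SL2_characters :: "('g, 'b) monoid_scheme \<Rightarrow> ('g \<Rightarrow> complex) set" where
  "SL2_characters G = rep_character G ` hom G SL2C"

definition Y_irr :: "nat \<Rightarrow> nat \<Rightarrow> (torus_gen gword set \<Rightarrow> complex) set" where
  "Y_irr m n = rep_character (torus_knot_group m n) ` irred_SU2_reps m n"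

lemma Y_irr_subset: "Y_irr m n \<subseteq> SL2_characters (torus_knot_group m n)"
proof -
  have "irred_SU2_reps m n \<subseteq> hom (torus_knot_group m n) SL2C"
    unfolding irred_SU2_reps_def hom_def SU2_def SL2C_def by auto
  then show ?thesis
    unfolding Y_irr_def SL2_characters_def by (rule image_mono)
qed

section \<open>Real algebraic structure\<close>

text \<open>
  A space is a topology together with its real-valued regular functions. On a subset \<open>S\<close> of a
  real affine variety the regular functions are the quotients \<open>p / q\<close> of polynomial
  functions where \<open>q\<close> has no zero on \<open>S\<close>. (Over the reals locally regular functions are
  globally of this form, so no sheaf is needed.) Membership in the set of regular functions
  depends only on the values on the underlying set of the space.
\<close>

record 'a real_space =
  topo :: "'a topology"
  regular :: "('a \<Rightarrow> real) set"

definition quotients_on :: "'a set \<Rightarrow> ('a \<Rightarrow> real) set \<Rightarrow> ('a \<Rightarrow> real) set" where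
  "quotients_on S P = {f. \<exists>p\<in>P. \<exists>q\<in>P. \<forall>s\<in>S. q s \<noteq> 0 \<and> f s = p s / q s}"

definition subspace_of :: "'a real_space \<Rightarrow> 'a set \<Rightarrow> 'a real_space" where
  "subspace_of V S =
    \<lparr>topo = subtopology (topo V) S, regular = quotients_on (topspace (topo V) \<inter> S) (regular V)\<rparr>"

definition affine_space :: "'a::euclidean_space real_space" where
  "affine_space =
    \<lparr>topo = euclidean, regular = quotients_on UNIV {p. real_polynomial_function p}\<rparr>"

definition quotient_topology :: "'a topology \<Rightarrow> ('a \<Rightarrow> 'b) \<Rightarrow> 'b topology" where
  "quotient_topology X p =
    topology (\<lambda>U. U \<subseteq> p ` topspace X \<and> openin X {x \<in> topspace X. p x \<in> U})"

lemma openin_quotient_topology: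
  "openin (quotient_topology X p) U \<longleftrightarrow>
    U \<subseteq> p ` topspace X \<and> openin X {x \<in> topspace X. p x \<in> U}"
proof -
  have "istopology (\<lambda>U. U \<subseteq> p ` topspace X \<and> openin X {x \<in> topspace X. p x \<in> U})"
    unfolding istopology_def
  proof (intro conjI allI impI)
    fix U V
    assume "U \<subseteq> p ` topspace X \<and> openin X {x \<in> topspace X. p x \<in> U}"
      "V \<subseteq> p ` topspace X \<and> openin X {x \<in> topspace X. p x \<in> V}"
    moreover have "{x \<in> topspace X. p x \<in> U \<inter> V} =
        {x \<in> topspace X. p x \<in> U} \<inter> {x \<in> topspace X. p x \<in> V}" by auto
    ultimately show "U \<inter> V \<subseteq> p ` topspace X" "openin X {x \<in> topspace X. p x \<in> U \<inter> V}"
      by auto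
  next
    fix K
    assume K: "\<forall>U\<in>K. U \<subseteq> p ` topspace X \<and> openin X {x \<in> topspace X. p x \<in> U}"
    then show "\<Union>K \<subseteq> p ` topspace X" by blast
    have "{x \<in> topspace X. p x \<in> \<Union>K} = (\<Union>U\<in>K. {x \<in> topspace X. p x \<in> U})" by auto
    with K show "openin X {x \<in> topspace X. p x \<in> \<Union>K}" by auto
  qed
  then show ?thesis
    unfolding quotient_topology_def by (simp add: topology_inverse')
qed

text \<open>
  For the quotient by a finite group the regular functions are the invariant regular
  functions.
\<close>

definition quotient_space :: "'a real_space \<Rightarrow> ('a \<Rightarrow> 'b) \<Rightarrow> 'b real_space" where
  "quotient_space V p =
    \<lparr>topo = quotient_topology (topo V) p, regular = {f. f \<circ> p \<in> regular V}\<rparr>"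

definition space_isomorphism :: "'a real_space \<Rightarrow> 'b real_space \<Rightarrow> ('a \<Rightarrow> 'b) \<Rightarrow> bool" where
  "space_isomorphism V W \<phi> \<longleftrightarrow>
    homeomorphic_map (topo V) (topo W) \<phi> \<and> (\<forall>f. f \<in> regular W \<longleftrightarrow> f \<circ> \<phi> \<in> regular V)"

text \<open>
  The complex algebraic structure of the character variety has the evaluations
  \<open>\<chi> \<mapsto> \<chi>(g)\<close> as coordinates (finitely many of them generate the others); the polynomial
  functions of the underlying real variety are generated by their real and imaginary parts.
\<close>

inductive_set char_polynomials :: "'g set \<Rightarrow> (('g \<Rightarrow> complex) \<Rightarrow> real) set" for C where
  char_const: "(\<lambda>_. c) \<in> char_polynomials C"
| char_Re: "g \<in> C \<Longrightarrow> (\<lambda>x. Re (x g)) \<in> char_polynomials C"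
| char_Im: "g \<in> C \<Longrightarrow> (\<lambda>x. Im (x g)) \<in> char_polynomials C"
| char_add: "p \<in> char_polynomials C \<Longrightarrow> q \<in> char_polynomials C \<Longrightarrow>
    (\<lambda>x. p x + q x) \<in> char_polynomials C"
| char_mult: "p \<in> char_polynomials C \<Longrightarrow> q \<in> char_polynomials C \<Longrightarrow>
    (\<lambda>x. p x * q x) \<in> char_polynomials C"

definition SL2_character_variety ::
    "('g, 'b) monoid_scheme \<Rightarrow> ('g \<Rightarrow> complex) real_space" where
  "SL2_character_variety G =
    \<lparr>topo = subtopology (product_topology (\<lambda>_. euclidean) (carrier G)) (SL2_characters G),
     regular = quotients_on (SL2_characters G) (char_polynomials (carrier G))\<rparr>"

definition Y_irr_space :: "nat \<Rightarrow> nat \<Rightarrow> (torus_gen gword set \<Rightarrow> complex) real_space" where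
  "Y_irr_space m n = subspace_of (SL2_character_variety (torus_knot_group m n)) (Y_irr m n)"

section \<open>The parameter space\<close>

definition param_set :: "nat \<Rightarrow> nat \<Rightarrow> (complex \<times> complex \<times> real) set" where
  "param_set m n = {(l, u, r).
     l ^ m = u ^ n \<and> l ^ m \<in> {1, -1} \<and> l \<notin> {1, -1} \<and> u \<notin> {1, -1} \<and> r < 0}"

fun swap_e :: "complex \<times> complex \<times> real \<Rightarrow> complex \<times> complex \<times> real" where
  "swap_e (l, u, r) = (inverse l, u, inverse r)"

fun swap_f :: "complex \<times> complex \<times> real \<Rightarrow> complex \<times> complex \<times> real" where
  "swap_f (l, u, r) = (l, inverse u, inverse r)"

abbreviation Z2_Z2 :: "(int \<times> int) monoid" where
  "Z2_Z2 \<equiv> integer_mod_group 2 \<times>\<times> integer_mod_group 2"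

definition Z2_Z2_action ::
    "nat \<Rightarrow> nat \<Rightarrow> int \<times> int \<Rightarrow> complex \<times> complex \<times> real \<Rightarrow> complex \<times> complex \<times> real" where
  "Z2_Z2_action m n = (\<lambda>(a, b). restrict ((swap_e ^^ nat a) \<circ> (swap_f ^^ nat b)) (param_set m n))"

lemma swap_involutive [simp]: "swap_e (swap_e t) = t" "swap_f (swap_f t) = t"
  by (cases t, simp, cases t, simp)

lemma swap_commute: "swap_f (swap_e t) = swap_e (swap_f t)"
  by (cases t; simp)

lemma swap_param_set:
  assumes "t \<in> param_set m n"
  shows "swap_e t \<in> param_set m n" "swap_f t \<in> param_set m n"
proof -
  obtain l u r where t: "t = (l, u, r)" by (cases t)
  have inv: "inverse z = 1 \<longleftrightarrow> z = 1" "inverse z = -1 \<longleftrightarrow> z = -1" for z :: complex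
    by (metis inverse_1 inverse_inverse_eq, metis inverse_1 inverse_inverse_eq inverse_minus_eq)
  from assms have lu: "l ^ m = u ^ n" "l ^ m = 1 \<or> l ^ m = -1" "r < 0"
      "l \<noteq> 1" "l \<noteq> -1" "u \<noteq> 1" "u \<noteq> -1"
    unfolding t param_set_def by auto
  have "inverse l ^ m = l ^ m" "inverse u ^ n = u ^ n"
    using lu(2) unfolding power_inverse lu(1) by auto
  with lu show "swap_e t \<in> param_set m n" "swap_f t \<in> param_set m n"
    unfolding t param_set_def swap_e.simps swap_f.simps by (simp_all add: inv)
qed

lemma carrier_Z2_Z2: "carrier Z2_Z2 = {(0, 0), (0, 1), (1, 0), (1, 1)}"
proof -
  have "{0..<2::int} = {0, 1}" by auto
  then show ?thesis by (auto simp: carrier_integer_mod_group)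
qed

lemma group_action_Z2_Z2: "group_action Z2_Z2 (param_set m n) (Z2_Z2_action m n)"
proof -
  let ?T = "param_set m n" and ?\<phi> = "Z2_Z2_action m n"
  have inv: "?\<phi> g t \<in> ?T \<and> ?\<phi> g (?\<phi> g t) = t" if "g \<in> carrier Z2_Z2" "t \<in> ?T" for g t
    using that unfolding carrier_Z2_Z2
    by (elim insertE emptyE; simp add: Z2_Z2_action_def swap_param_set swap_commute)
  have bij: "?\<phi> g \<in> Bij ?T" if "g \<in> carrier Z2_Z2" for g
  proof -
    have "bij_betw (?\<phi> g) ?T ?T"
      using inv[OF that] by (intro bij_betwI[where g = "?\<phi> g"]) auto
    moreover have "?\<phi> g \<in> extensional ?T"
      by (cases g) (simp add: Z2_Z2_action_def)
    ultimately show ?thesis by (simp add: Bij_def)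
  qed
  have "group Z2_Z2"
    by (intro DirProd_group group_integer_mod_group)
  moreover have "?\<phi> \<in> hom Z2_Z2 (BijGroup ?T)"
    unfolding hom_def
  proof (intro CollectI conjI ballI)
    show "?\<phi> \<in> carrier Z2_Z2 \<rightarrow> carrier (BijGroup ?T)"
      using bij by (auto simp: BijGroup_def)
    fix g h assume gh: "g \<in> carrier Z2_Z2" "h \<in> carrier Z2_Z2"
    have "?\<phi> (g \<otimes>\<^bsub>Z2_Z2\<^esub> h) = compose ?T (?\<phi> g) (?\<phi> h)"
    proof (rule extensionalityI[of _ ?T])
      show "?\<phi> (g \<otimes>\<^bsub>Z2_Z2\<^esub> h) \<in> extensional ?T"
        by (cases "g \<otimes>\<^bsub>Z2_Z2\<^esub> h") (simp add: Z2_Z2_action_def)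
      fix t assume "t \<in> ?T"
      then show "?\<phi> (g \<otimes>\<^bsub>Z2_Z2\<^esub> h) t = compose ?T (?\<phi> g) (?\<phi> h) t"
        using gh unfolding carrier_Z2_Z2
        by (elim insertE emptyE; simp add: Z2_Z2_action_def compose_def integer_mod_group_def
            swap_param_set swap_commute)
    qed (simp add: compose_def)
    then show "?\<phi> (g \<otimes>\<^bsub>Z2_Z2\<^esub> h) = ?\<phi> g \<otimes>\<^bsub>BijGroup ?T\<^esub> ?\<phi> h"
      using bij[OF gh(1)] bij[OF gh(2)] by (simp add: BijGroup_def)
  qed
  ultimately show ?thesis
    by (simp add: group_action_def group_hom_def group_hom_axioms_def group_BijGroup)
qed

definition param_quotient :: "nat \<Rightarrow> nat \<Rightarrow> (complex \<times> complex \<times> real) set real_space" where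
  "param_quotient m n =
    quotient_space (subspace_of affine_space (param_set m n)) (orbit Z2_Z2 (Z2_Z2_action m n))"

lemma topspace_param_quotient:
  "topspace (topo (param_quotient m n)) = orbits Z2_Z2 (param_set m n) (Z2_Z2_action m n)"
proof -
  let ?X = "top_of_set (param_set m n)" and ?p = "orbit Z2_Z2 (Z2_Z2_action m n)"
  have pre: "{x \<in> topspace ?X. ?p x \<in> ?p ` topspace ?X} = topspace ?X"
    by blast
  have "openin (quotient_topology ?X ?p) (?p ` topspace ?X)"
    unfolding openin_quotient_topology pre by (intro conjI order_refl openin_topspace)
  then have "?p ` topspace ?X \<subseteq> topspace (quotient_topology ?X ?p)"
    by (rule openin_subset)
  moreover have "topspace (quotient_topology ?X ?p) \<subseteq> ?p ` topspace ?X"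
    by (rule openin_quotient_topology[THEN iffD1, OF openin_topspace, THEN conjunct1])
  ultimately have "topspace (quotient_topology ?X ?p) = ?p ` param_set m n"
    by (metis subset_antisym topspace_euclidean_subtopology)
  moreover have "topo (param_quotient m n) = quotient_topology ?X ?p"
    unfolding param_quotient_def quotient_space_def subspace_of_def affine_space_def by simp
  ultimately show ?thesis
    unfolding orbits_def image_def by (simp only: Bex_def) blast
qed

section \<open>The parameters of a representation\<close>

text \<open>
  Points of the projective line are given by homogeneous coordinates. The formula is the
  homogeneous form of \<open>[a, b, p, q] = ((p - a) (q - b)) / ((q - a) (p - b))\<close>.
\<close>

definition bracket :: "complex^2 \<Rightarrow> complex^2 \<Rightarrow> complex" where
  "bracket v w = v $ 1 * w $ 2 - v $ 2 * w $ 1"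

definition cross_ratio :: "complex^2 \<Rightarrow> complex^2 \<Rightarrow> complex^2 \<Rightarrow> complex^2 \<Rightarrow> complex" where
  "cross_ratio e1 e2 f1 f2 =
    (bracket e1 f1 * bracket e2 f2) / (bracket e1 f2 * bracket e2 f1)"

lemma cross_ratio_normalized:
  "cross_ratio (vector [0, 1]) (vector [1, 0]) (vector [p, 1]) (vector [q, 1]) = p / q"
  by (simp add: cross_ratio_def bracket_def)

lemma cross_ratio_scale:
  assumes "a \<noteq> 0" "b \<noteq> 0" "c \<noteq> 0" "d \<noteq> 0"
  shows "cross_ratio (a *s e1) (b *s e2) (c *s f1) (d *s f2) = cross_ratio e1 e2 f1 f2"
proof -
  have br: "bracket (s *s v) (t *s w) = s * t * bracket v w" for s t v w
    by (simp add: bracket_def algebra_simps)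
  have "cross_ratio (a *s e1) (b *s e2) (c *s f1) (d *s f2) =
      ((a * b * c * d) * (bracket e1 f1 * bracket e2 f2)) /
      ((a * b * c * d) * (bracket e1 f2 * bracket e2 f1))"
    unfolding cross_ratio_def br by (simp only: ac_simps)
  then show ?thesis
    using assms unfolding cross_ratio_def by simp
qed

lemma cross_ratio_projective:
  assumes "det P \<noteq> 0"
  shows "cross_ratio (P *v e1) (P *v e2) (P *v f1) (P *v f2) = cross_ratio e1 e2 f1 f2"
proof -
  have br: "bracket (P *v v) (P *v w) = det P * bracket v w" for v w
    by (simp add: bracket_def det_2 matrix_vector_mult_def sum_2 algebra_simps)
  have "cross_ratio (P *v e1) (P *v e2) (P *v f1) (P *v f2) =
      ((det P * det P) * (bracket e1 f1 * bracket e2 f2)) /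
      ((det P * det P) * (bracket e1 f2 * bracket e2 f1))"
    unfolding cross_ratio_def br by (simp only: ac_simps)
  then show ?thesis
    using assms unfolding cross_ratio_def by simp
qed

text \<open>All triples obtained from \<open>(A, B)\<close> by ordering the two pairs of eigenlines.\<close>

definition triples_of :: "complex^2^2 \<Rightarrow> complex^2^2 \<Rightarrow> (complex \<times> complex \<times> real) set" where
  "triples_of A B = {(l, u, r). \<exists>e1 e2 f1 f2.
     has_eigenvector A l e1 \<and> has_eigenvector A (inverse l) e2 \<and>
     has_eigenvector B u f1 \<and> has_eigenvector B (inverse u) f2 \<and>
     cross_ratio e1 e2 f1 f2 = complex_of_real r}"

section \<open>Disjoint unions of open intervals\<close>

definition interval_union :: "nat \<Rightarrow> (real \<times> real) real_space" where
  "interval_union N = subspace_of affine_space (real ` {..<N} \<times> {0<..<1})"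

end

theory Submission
  imports Defs
begin

text \<open>
  For an irreducible pair \<open>(A, B)\<close> the matrix \<open>A^m = B^n\<close> is scalar, so the eigenvalues \<open>l, u\<close>
  satisfy \<open>l^m = u^n = \<plusminus>1\<close>. Scaling the eigenvectors \<open>e1, e2\<close> of \<open>A\<close> so that their sum is an
  eigenvector of \<open>B\<close> brings the pair into a normal form that depends only on \<open>l, u\<close> and the
  cross ratio \<open>r\<close>. With \<open>s = 1 / (1 - r)\<close> its entries are affine functions of \<open>s\<close>, so every
  character value is polynomial in \<open>s\<close>, while \<open>s\<close> is an affine function of the trace of \<open>A B\<close>.
  For unitary pairs the eigenlines of each matrix are orthogonal, which makes \<open>r\<close> negative, that
  is \<open>0 < s < 1\<close>; conversely a diagonal conjugation makes the normal form unitary for all these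
  \<open>s\<close>. Hence each of the three spaces is a disjoint union of copies of the interval \<open>(0, 1)\<close>,
  indexed by the pairs \<open>(l, u)\<close> in the upper half plane, and on each of them the topology and the
  regular functions are the usual topology and the rational functions of \<open>s\<close>.
\<close>

section \<open>Finite unions of rational curves\<close>

text \<open>A representation comes with no chosen eigenlines, so neither continuity nor regularity
  of the map to triples can be read off from eigenvectors. Instead both spaces get atlases indexed
  by the same pairs \<open>(l, u)\<close>; the isomorphism transports the parameter
  \<open>s\<close>, and its agreement with the triples becomes a pointwise statement. The choice of
  \<open>s\<close> has two further reasons. It turns the inversion of \<open>r\<close> into the
  reflection \<open>s \<mapsto> 1 - s\<close>, which preserves the rational functions without pole
  on the interval, so invariants of the action are seen on one representative curve. For unit
  eigenvectors \<open>e1\<close>, \<open>f1\<close> of a unitary pair it is the squared modulus of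
  their Hermitian product, and irreducibility excludes the endpoints. The unitary model itself
  involves square roots of \<open>s\<close> and \<open>1 - s\<close>, which the nonunitary normal
  form avoids.\<close>

lemma quotients_on_mono: "P \<subseteq> Q \<Longrightarrow> quotients_on S P \<subseteq> quotients_on S Q"
  unfolding quotients_on_def by blast

lemma quotients_onI:
  assumes "p \<in> P" "q \<in> P" "\<And>s. s \<in> S \<Longrightarrow> q s \<noteq> 0" "\<And>s. s \<in> S \<Longrightarrow> f s = p s / q s"
  shows "f \<in> quotients_on S P"
  using assms unfolding quotients_on_def mem_Collect_eq
  by (intro bexI[of _ p] bexI[of _ q] ballI conjI)

lemma quotients_onE:
  assumes "f \<in> quotients_on S P"
  obtains p q where "p \<in> P" "q \<in> P" "\<And>s. s \<in> S \<Longrightarrow> q s \<noteq> 0" "\<And>s. s \<in> S \<Longrightarrow> f s = p s / q s"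
  using assms unfolding quotients_on_def mem_Collect_eq by (elim bexE) simp

text \<open>One interface for polynomials in one variable, polynomial functions on affine space and
  polynomials in character values; their algebras of quotients are again instances.\<close>

locale function_algebra =
  fixes P :: "('a \<Rightarrow> real) set"
  assumes const: "(\<lambda>_. c) \<in> P"
    and add: "p \<in> P \<Longrightarrow> q \<in> P \<Longrightarrow> (\<lambda>x. p x + q x) \<in> P"
    and mult: "p \<in> P \<Longrightarrow> q \<in> P \<Longrightarrow> (\<lambda>x. p x * q x) \<in> P"
begin

lemma sum: "finite I \<Longrightarrow> (\<And>i. i \<in> I \<Longrightarrow> p i \<in> P) \<Longrightarrow> (\<lambda>x. \<Sum>i\<in>I. p i x) \<in> P"
  by (induction I rule: finite_induct) (simp_all add: const add)

lemma prod: "finite I \<Longrightarrow> (\<And>i. i \<in> I \<Longrightarrow> p i \<in> P) \<Longrightarrow> (\<lambda>x. \<Prod>i\<in>I. p i x) \<in> P"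
  by (induction I rule: finite_induct) (simp_all add: const mult)

lemma poly_comp: "p \<in> P \<Longrightarrow> (\<lambda>x. poly a (p x)) \<in> P"
  by (induction a) (simp_all add: const add mult)

lemma subset_quotients: "P \<subseteq> quotients_on S P"
proof
  fix p assume "p \<in> P"
  then show "p \<in> quotients_on S P"
    by (rule quotients_onI[OF _ const[of 1]]) simp_all
qed

lemma function_algebra_quotients: "function_algebra (quotients_on S P)"
proof
  fix f g assume "f \<in> quotients_on S P" "g \<in> quotients_on S P"
  then obtain a b c d where P: "a \<in> P" "b \<in> P" "c \<in> P" "d \<in> P"
    and nz: "\<And>s. s \<in> S \<Longrightarrow> b s \<noteq> 0" "\<And>s. s \<in> S \<Longrightarrow> d s \<noteq> 0"
    and fg: "\<And>s. s \<in> S \<Longrightarrow> f s = a s / b s" "\<And>s. s \<in> S \<Longrightarrow> g s = c s / d s"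
    by (elim quotients_onE) simp
  have bd: "(\<lambda>x. b x * d x) \<in> P"
    using P by (simp add: mult)
  have "(\<lambda>x. a x * d x + c x * b x) \<in> P"
    using P by (simp add: add mult)
  then show "(\<lambda>x. f x + g x) \<in> quotients_on S P"
    by (rule quotients_onI[OF _ bd]) (simp_all add: nz fg add_frac_eq)
  have "(\<lambda>x. a x * c x) \<in> P"
    using P by (simp add: mult)
  then show "(\<lambda>x. f x * g x) \<in> quotients_on S P"
    by (rule quotients_onI[OF _ bd]) (simp_all add: nz fg)
qed (rule subsetD[OF subset_quotients const])

lemma quotients_divide:
  assumes "f \<in> quotients_on S P" "g \<in> quotients_on S P" "\<And>s. s \<in> S \<Longrightarrow> g s \<noteq> 0"
    and "\<And>s. s \<in> S \<Longrightarrow> h s = f s / g s"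
  shows "h \<in> quotients_on S P"
proof -
  obtain a b c d where P: "a \<in> P" "b \<in> P" "c \<in> P" "d \<in> P"
    and nz: "\<And>s. s \<in> S \<Longrightarrow> b s \<noteq> 0" "\<And>s. s \<in> S \<Longrightarrow> d s \<noteq> 0"
    and fg: "\<And>s. s \<in> S \<Longrightarrow> f s = a s / b s" "\<And>s. s \<in> S \<Longrightarrow> g s = c s / d s"
    using assms(1,2) by (elim quotients_onE) simp
  have "(\<lambda>x. a x * d x) \<in> P" "(\<lambda>x. b x * c x) \<in> P"
    using P by (simp_all add: mult)
  then show ?thesis
  proof (rule quotients_onI)
    fix s assume s: "s \<in> S"
    show "b s * c s \<noteq> 0"
      using nz(1)[OF s] assms(3)[OF s] fg(2)[OF s] by auto
    show "h s = a s * d s / (b s * c s)"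
      using assms(4)[OF s] fg[OF s] by simp
  qed
qed

text \<open>A subspace takes quotients of functions that are already quotients on the larger space;
  this collapses the two stages into quotients of the original functions.\<close>

lemma quotients_on_quotients_on:
  assumes "S \<subseteq> T"
  shows "quotients_on S (quotients_on T P) = quotients_on S P"
proof
  have sub: "quotients_on T P \<subseteq> quotients_on S P"
    using assms unfolding quotients_on_def by blast
  show "quotients_on S (quotients_on T P) \<subseteq> quotients_on S P"
  proof
    fix f assume "f \<in> quotients_on S (quotients_on T P)"
    then obtain p q where "p \<in> quotients_on T P" "q \<in> quotients_on T P"
        and "\<And>s. s \<in> S \<Longrightarrow> q s \<noteq> 0" "\<And>s. s \<in> S \<Longrightarrow> f s = p s / q s"
      by (erule quotients_onE)
    then show "f \<in> quotients_on S P"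
      by (rule quotients_divide[OF subsetD[OF sub] subsetD[OF sub]])
  qed
  show "quotients_on S P \<subseteq> quotients_on S (quotients_on T P)"
    by (intro quotients_on_mono subset_quotients)
qed

end

section \<open>Rational functions on the open unit interval and curves parametrized by it\<close>

lemma function_algebra_poly: "function_algebra (range (poly :: real poly \<Rightarrow> real \<Rightarrow> real))"
proof
  fix p q :: "real \<Rightarrow> real" assume "p \<in> range poly" "q \<in> range poly"
  then obtain a b where "p = poly a" "q = poly b" by blast
  then have "(\<lambda>x. p x + q x) = poly (a + b)" "(\<lambda>x. p x * q x) = poly (a * b)" by (simp_all add: fun_eq_iff)
  then show "(\<lambda>x. p x + q x) \<in> range poly" "(\<lambda>x. p x * q x) \<in> range poly" by simp_all
next
  fix c :: real
  have "(\<lambda>_. c) = poly [:c:]" by (simp add: fun_eq_iff)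
  then show "(\<lambda>_. c) \<in> range poly" by simp
qed

abbreviation unit_rational :: "(real \<Rightarrow> real) set" where
  "unit_rational \<equiv> quotients_on {0<..<1} (range poly)"

text \<open>Under \<open>r = 1 - 1 / s\<close> the inversion of \<open>r\<close> is
  \<open>s \<mapsto> 1 - s\<close>; hence curves exchanged by one swap impose the same regularity
  condition.\<close>

lemma unit_rational_reflect:
  assumes "f \<in> unit_rational"
  shows "(\<lambda>s. f (1 - s)) \<in> unit_rational"
proof -
  obtain p q where pq: "\<And>s. s \<in> {0<..<1} \<Longrightarrow> poly q s \<noteq> 0"
      "\<And>s. s \<in> {0<..<1} \<Longrightarrow> f s = poly p s / poly q s"
    using assms by (elim quotients_onE) blast
  show ?thesis
    by (rule quotients_onI[of "poly (pcompose p [:1, -1:])" _ "poly (pcompose q [:1, -1:])"])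
      (simp_all add: poly_pcompose pq)
qed

text \<open>The index set alone determines the space up to isomorphism: topology and regular
  functions are those of a disjoint union of copies of the interval. Openness along a curve can be
  taken in the real line because the interval is open.\<close>

definition curve_atlas :: "'a real_space \<Rightarrow> 'k set \<Rightarrow> ('k \<times> real \<Rightarrow> 'a) \<Rightarrow> bool" where
  "curve_atlas V K \<gamma> \<longleftrightarrow>
    inj_on \<gamma> (K \<times> {0<..<1}) \<and> topspace (topo V) = \<gamma> ` (K \<times> {0<..<1}) \<and>
    (\<forall>U \<subseteq> topspace (topo V).
      openin (topo V) U \<longleftrightarrow> (\<forall>k\<in>K. open {s \<in> {0<..<1}. \<gamma> (k, s) \<in> U})) \<and>
    (\<forall>f. f \<in> regular V \<longleftrightarrow> (\<forall>k\<in>K. (\<lambda>s. f (\<gamma> (k, s))) \<in> unit_rational))"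

lemma
  assumes "curve_atlas V K \<gamma>"
  shows curve_atlas_inj: "inj_on \<gamma> (K \<times> {0<..<1})"
    and curve_atlas_topspace: "topspace (topo V) = \<gamma> ` (K \<times> {0<..<1})"
    and curve_atlas_openin: "U \<subseteq> topspace (topo V) \<Longrightarrow>
      openin (topo V) U \<longleftrightarrow> (\<forall>k\<in>K. open {s \<in> {0<..<1}. \<gamma> (k, s) \<in> U})"
    and curve_atlas_regular:
      "f \<in> regular V \<longleftrightarrow> (\<forall>k\<in>K. (\<lambda>s. f (\<gamma> (k, s))) \<in> unit_rational)"
  using assms by (simp_all only: curve_atlas_def)

lemma unit_rational_cong:
  assumes "\<And>s. 0 < s \<Longrightarrow> s < 1 \<Longrightarrow> f s = g s"
  shows "f \<in> unit_rational \<longleftrightarrow> g \<in> unit_rational"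
  using assms by (simp add: quotients_on_def)

text \<open>Pulled back along the curves, each condition on one side becomes the condition on the
  other side with the indices renamed by \<open>b\<close>.\<close>

lemma space_isomorphism_atlas:
  assumes V: "curve_atlas V K \<gamma>" and W: "curve_atlas W L \<delta>" and b: "bij_betw b K L"
    and \<phi>: "\<And>k s. k \<in> K \<Longrightarrow> 0 < s \<Longrightarrow> s < 1 \<Longrightarrow> \<phi> (\<gamma> (k, s)) = \<delta> (b k, s)"
  shows "space_isomorphism V W \<phi>"
proof -
  have bK: "b ` K = L" and inj_b: "inj_on b K"
    using b by (auto simp: bij_betw_def)
  have topV: "topspace (topo V) = \<gamma> ` (K \<times> {0<..<1})"
    and topW: "topspace (topo W) = \<delta> ` (L \<times> {0<..<1})"
    and inj: "inj_on \<delta> (L \<times> {0<..<1})"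
    using curve_atlas_topspace[OF V] curve_atlas_topspace[OF W] curve_atlas_inj[OF W] by auto
  have img: "\<phi> ` topspace (topo V) = topspace (topo W)"
  proof -
    have "\<phi> ` topspace (topo V) = (\<lambda>(k, s). \<delta> (b k, s)) ` (K \<times> {0<..<1})"
      unfolding topV image_image by (rule image_cong) (auto simp: \<phi>)
    also have "\<dots> = \<delta> ` (b ` K \<times> {0<..<1})"
      by force
    finally show ?thesis
      unfolding topW bK .
  qed
  have "inj_on \<phi> (topspace (topo V))"
  proof (rule inj_onI)
    fix x y assume "x \<in> topspace (topo V)" "y \<in> topspace (topo V)" and eq: "\<phi> x = \<phi> y"
    then obtain k s l t where x: "x = \<gamma> (k, s)" "k \<in> K" "0 < s" "s < 1"
      and y: "y = \<gamma> (l, t)" "l \<in> K" "0 < t" "t < 1"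
      unfolding topV by auto
    have "\<delta> (b k, s) = \<delta> (b l, t)"
      using eq x y \<phi> by simp
    then have "(b k, s) = (b l, t)"
      by (rule inj_onD[OF inj]) (use x y bK in auto)
    with inj_b x y show "x = y"
      by (simp add: inj_on_eq_iff)
  qed
  \<comment> \<open>A homeomorphism is an injective quotient map, so it is enough to compare
    \<open>U\<close> with its preimage.\<close>
  moreover have "openin (topo V) {x \<in> topspace (topo V). \<phi> x \<in> U} \<longleftrightarrow> openin (topo W) U"
    if U: "U \<subseteq> topspace (topo W)" for U
  proof -
    let ?U = "{x \<in> topspace (topo V). \<phi> x \<in> U}"
    have "{s \<in> {0<..<1}. \<gamma> (k, s) \<in> ?U} = {s \<in> {0<..<1}. \<delta> (b k, s) \<in> U}" if "k \<in> K" for k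
      using that \<phi>[OF that] unfolding topV by force
    moreover have "openin (topo V) ?U \<longleftrightarrow> (\<forall>k\<in>K. open {s \<in> {0<..<1}. \<gamma> (k, s) \<in> ?U})"
      by (rule curve_atlas_openin[OF V]) blast
    moreover have "openin (topo W) U \<longleftrightarrow> (\<forall>k\<in>L. open {s \<in> {0<..<1}. \<delta> (k, s) \<in> U})"
      by (rule curve_atlas_openin[OF W U])
    ultimately show ?thesis
      unfolding bK[symmetric] by simp
  qed
  ultimately have "homeomorphic_map (topo V) (topo W) \<phi>"
    unfolding homeomorphic_map_def quotient_map_def using img by blast
  moreover have "f \<in> regular W \<longleftrightarrow> f \<circ> \<phi> \<in> regular V" for f
  proof -
    have "(\<lambda>s. (f \<circ> \<phi>) (\<gamma> (k, s))) \<in> unit_rational \<longleftrightarrow> (\<lambda>s. f (\<delta> (b k, s))) \<in> unit_rational"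
      if "k \<in> K" for k
      by (rule unit_rational_cong) (simp add: \<phi> that)
    then show ?thesis
      unfolding curve_atlas_regular[OF V] curve_atlas_regular[OF W] bK[symmetric] by simp
  qed
  ultimately show ?thesis
    unfolding space_isomorphism_def by blast
qed

text \<open>
  A function that is rational along every curve is glued from its restrictions by functions
  of \<open>P\<close> that are \<open>1\<close> on one curve and \<open>0\<close> on all the others.
\<close>

lemma curve_atlasI:
  assumes K: "finite K" and P: "function_algebra P"
    and reg: "regular V = quotients_on (topspace (topo V)) P"
    and top: "topspace (topo V) = \<gamma> ` (K \<times> {0<..<1})"
    and cont_P: "\<And>p. p \<in> P \<Longrightarrow> continuous_map (topo V) euclideanreal p"
    and cont_\<gamma>: "\<And>k. k \<in> K \<Longrightarrow> continuous_map (top_of_set {0<..<1}) (topo V) (\<lambda>s. \<gamma> (k, s))"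
    and rat: "\<And>p k. p \<in> P \<Longrightarrow> k \<in> K \<Longrightarrow> (\<lambda>s. p (\<gamma> (k, s))) \<in> unit_rational"
    and sep: "\<And>j k. j \<in> K \<Longrightarrow> k \<in> K \<Longrightarrow> j \<noteq> k \<Longrightarrow>
      \<exists>p\<in>P. \<exists>a b. a \<noteq> b \<and> (\<forall>s\<in>{0<..<1}. p (\<gamma> (j, s)) = a \<and> p (\<gamma> (k, s)) = b)"
    and coord: "\<And>k. k \<in> K \<Longrightarrow> \<exists>p\<in>P. \<exists>q\<in>P. (\<forall>x\<in>topspace (topo V). q x \<noteq> 0) \<and>
      (\<forall>s\<in>{0<..<1}. p (\<gamma> (k, s)) = s * q (\<gamma> (k, s)))"
  shows "curve_atlas V K \<gamma>"
proof -
  let ?I = "{0<..<1::real}" and ?S = "topspace (topo V)"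
  let ?Q = "quotients_on ?S P"
  interpret P: function_algebra P by (fact P)
  interpret Q: function_algebra ?Q by (rule P.function_algebra_quotients)
  interpret R: function_algebra "range (poly :: real poly \<Rightarrow> real \<Rightarrow> real)"
    by (rule function_algebra_poly)
  have "\<exists>\<theta>\<in>P. \<forall>k\<in>K. \<forall>s\<in>?I. \<theta> (\<gamma> (k, s)) = (if k = j then 1 else 0)" if j: "j \<in> K" for j
  proof -
    have "\<forall>k\<in>K - {j}. \<exists>p\<in>P. \<forall>s\<in>?I. p (\<gamma> (j, s)) = 1 \<and> p (\<gamma> (k, s)) = 0"
    proof
      fix k assume "k \<in> K - {j}"
      then obtain p a b where p: "p \<in> P" and ab: "a \<noteq> b"
        and eq: "\<forall>s\<in>?I. p (\<gamma> (j, s)) = a \<and> p (\<gamma> (k, s)) = b"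
        using sep[of j k] j by blast
      \<comment> \<open>The affine function sending \<open>a\<close> to 1 and \<open>b\<close> to 0
        normalizes the separating function.\<close>
      have "(\<lambda>x. 1 / (a - b) * (p x + - b)) \<in> P"
        by (intro P.mult P.add P.const p)
      with ab eq show "\<exists>p\<in>P. \<forall>s\<in>?I. p (\<gamma> (j, s)) = 1 \<and> p (\<gamma> (k, s)) = 0"
        by (intro bexI[of _ "\<lambda>x. 1 / (a - b) * (p x + - b)"]) auto
    qed
    then obtain p where p: "\<And>k. k \<in> K - {j} \<Longrightarrow> p k \<in> P"
        "\<And>k s. k \<in> K - {j} \<Longrightarrow> s \<in> ?I \<Longrightarrow> p k (\<gamma> (j, s)) = 1 \<and> p k (\<gamma> (k, s)) = 0"
      by metis
    \<comment> \<open>The product of the normalized separators is the indicator of curve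
      \<open>j\<close> on the union of all curves.\<close>
    let ?\<theta> = "\<lambda>x. \<Prod>k\<in>K - {j}. p k x"
    have "?\<theta> \<in> P"
      using K p(1) by (intro P.prod) auto
    moreover have "?\<theta> (\<gamma> (k, s)) = (if k = j then 1 else 0)" if "k \<in> K" "s \<in> ?I" for k s
      using that p(2) K by (auto intro!: prod.neutral prod_zero)
    ultimately show ?thesis
      by (intro bexI[of _ ?\<theta>] ballI)
  qed
  then obtain \<theta> where \<theta>_P: "\<And>j. j \<in> K \<Longrightarrow> \<theta> j \<in> P"
    and \<theta>: "\<And>j k s. j \<in> K \<Longrightarrow> k \<in> K \<Longrightarrow> s \<in> ?I \<Longrightarrow> \<theta> j (\<gamma> (k, s)) = (if k = j then 1 else 0)"
    by metis
  \<comment> \<open>The coordinate is allowed to be a quotient because on the parameter set it is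
    \<open>s = 1 / (1 - r)\<close>. Its denominator has no zero on any curve, so it is continuous on
    the whole space.\<close>
  have "\<forall>k\<in>K. \<exists>\<sigma>\<in>?Q. continuous_map (topo V) euclideanreal \<sigma> \<and> (\<forall>s\<in>?I. \<sigma> (\<gamma> (k, s)) = s)"
  proof
    fix k assume k: "k \<in> K"
    obtain p q where P: "p \<in> P" "q \<in> P" and q: "\<forall>x\<in>?S. q x \<noteq> 0"
      and pq: "\<forall>s\<in>?I. p (\<gamma> (k, s)) = s * q (\<gamma> (k, s))"
      using coord[OF k] by blast
    have "(\<lambda>x. p x / q x) \<in> ?Q"
      using P q by (intro quotients_onI[of p P q]) simp_all
    moreover have "continuous_map (topo V) euclideanreal (\<lambda>x. p x / q x)"
      using q by (intro continuous_map_real_divide cont_P P) auto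
    moreover have "p (\<gamma> (k, s)) / q (\<gamma> (k, s)) = s" if "s \<in> ?I" for s
      using pq q that k unfolding top by force
    ultimately show "\<exists>\<sigma>\<in>?Q. continuous_map (topo V) euclideanreal \<sigma> \<and> (\<forall>s\<in>?I. \<sigma> (\<gamma> (k, s)) = s)"
      by (intro bexI[of _ "\<lambda>x. p x / q x"]) auto
  qed
  then obtain \<sigma> where \<sigma>_Q: "\<And>k. k \<in> K \<Longrightarrow> \<sigma> k \<in> ?Q"
    and \<sigma>_cont: "\<And>k. k \<in> K \<Longrightarrow> continuous_map (topo V) euclideanreal (\<sigma> k)"
    and \<sigma>: "\<And>k s. k \<in> K \<Longrightarrow> s \<in> ?I \<Longrightarrow> \<sigma> k (\<gamma> (k, s)) = s"
    by metis
  have "inj_on \<gamma> (K \<times> ?I)"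
  proof (rule inj_onI, clarify)
    fix j s k t assume js: "j \<in> K" "s \<in> ?I" and kt: "k \<in> K" "t \<in> ?I"
      and eq: "\<gamma> (j, s) = \<gamma> (k, t)"
    from \<theta>[of j k t] \<theta>[of j j s] js kt eq have "j = k"
      by (auto split: if_splits)
    with eq \<sigma> js kt show "j = k \<and> s = t"
      by metis
  qed
  moreover have "openin (topo V) U \<longleftrightarrow> (\<forall>k\<in>K. open {s \<in> ?I. \<gamma> (k, s) \<in> U})" if U: "U \<subseteq> ?S" for U
  proof
    assume op: "openin (topo V) U"
    show "\<forall>k\<in>K. open {s \<in> ?I. \<gamma> (k, s) \<in> U}"
      using openin_continuous_map_preimage[OF cont_\<gamma> op] by (auto intro: openin_open_trans[OF _ open_greaterThanLessThan])
  next
    assume op: "\<forall>k\<in>K. open {s \<in> ?I. \<gamma> (k, s) \<in> U}"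
    \<comment> \<open>As \<open>\<theta> k\<close> takes only the values 0 and 1 on the space, the
      threshold 1/2 cuts out exactly curve \<open>k\<close> by an open condition.\<close>
    let ?U = "\<lambda>k. {x \<in> ?S. \<theta> k x \<in> {1/2<..}} \<inter> {x \<in> ?S. \<sigma> k x \<in> {s \<in> ?I. \<gamma> (k, s) \<in> U}}"
    have "openin (topo V) (?U k)" if "k \<in> K" for k
      using that op
      by (intro openin_Int openin_continuous_map_preimage[OF cont_P]
          openin_continuous_map_preimage[OF \<sigma>_cont] \<theta>_P) auto
    moreover have "U = (\<Union>k\<in>K. ?U k)"
    proof (intro equalityI subsetI)
      fix x assume x: "x \<in> U"
      then obtain k s where "x = \<gamma> (k, s)" "k \<in> K" "s \<in> ?I"
        using U unfolding top by auto
      with x U show "x \<in> (\<Union>k\<in>K. ?U k)"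
        using \<theta> \<sigma> by (intro UN_I[of k]) auto
    next
      fix x assume "x \<in> (\<Union>k\<in>K. ?U k)"
      then obtain k where k: "k \<in> K" and x: "x \<in> ?U k" by blast
      then obtain j s where js: "x = \<gamma> (j, s)" "j \<in> K" "s \<in> ?I"
        unfolding top by auto
      have "j = k"
        using x \<theta>[of k j s] k js by (auto split: if_splits)
      with x k js \<sigma> show "x \<in> U" by auto
    qed
    ultimately show "openin (topo V) U"
      by (metis (no_types, lifting) openin_Union imageE)
  qed
  moreover have "f \<in> regular V \<longleftrightarrow> (\<forall>k\<in>K. (\<lambda>s. f (\<gamma> (k, s))) \<in> unit_rational)" for f
  proof
    assume "f \<in> regular V"
    then obtain p q where P: "p \<in> P" "q \<in> P"
      and f: "\<And>x. x \<in> ?S \<Longrightarrow> q x \<noteq> 0" "\<And>x. x \<in> ?S \<Longrightarrow> f x = p x / q x"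
      unfolding reg by (rule quotients_onE) blast
    show "\<forall>k\<in>K. (\<lambda>s. f (\<gamma> (k, s))) \<in> unit_rational"
    proof
      fix k assume k: "k \<in> K"
      then have "\<gamma> (k, s) \<in> ?S" if "s \<in> ?I" for s
        using that unfolding top by blast
      then show "(\<lambda>s. f (\<gamma> (k, s))) \<in> unit_rational"
        by (intro R.quotients_divide[OF rat[OF P(1) k] rat[OF P(2) k]]) (simp_all add: f)
    qed
  next
    assume f: "\<forall>k\<in>K. (\<lambda>s. f (\<gamma> (k, s))) \<in> unit_rational"
    have "\<exists>a b. \<forall>s\<in>?I. poly b s \<noteq> 0 \<and> f (\<gamma> (k, s)) = poly a s / poly b s" if k: "k \<in> K" for k
    proof -
      obtain p q where "p \<in> range poly" "q \<in> range poly"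
        and pq: "\<And>s. s \<in> ?I \<Longrightarrow> q s \<noteq> 0" "\<And>s. s \<in> ?I \<Longrightarrow> f (\<gamma> (k, s)) = p s / q s"
        using bspec[OF f k] by (erule quotients_onE)
      then obtain a b where "p = poly a" "q = poly b" by (elim rangeE)
      with pq show ?thesis
        by (intro exI[of _ a] exI[of _ b]) simp
    qed
    then obtain a b where ab: "\<And>k s. k \<in> K \<Longrightarrow> s \<in> ?I \<Longrightarrow>
        poly (b k) s \<noteq> 0 \<and> f (\<gamma> (k, s)) = poly (a k) s / poly (b k) s"
      by metis
    \<comment> \<open>Numerators and denominators are glued separately. On curve \<open>j\<close>
      the glued denominator is \<open>poly (b j) s\<close>, hence nonzero, and the glued fraction is
      \<open>f\<close>.\<close>
    have glue_Q: "(\<lambda>x. \<Sum>k\<in>K. \<theta> k x * poly (c k) (\<sigma> k x)) \<in> ?Q" for c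
      using K \<theta>_P \<sigma>_Q P.subset_quotients by (intro Q.sum Q.mult Q.poly_comp) auto
    have glue: "(\<Sum>k\<in>K. \<theta> k x * poly (c k) (\<sigma> k x)) = poly (c j) s"
      if "x = \<gamma> (j, s)" "j \<in> K" "s \<in> ?I" for c x j s
    proof -
      have "(\<Sum>k\<in>K. \<theta> k x * poly (c k) (\<sigma> k x)) = (\<Sum>k\<in>K. if k = j then poly (c j) s else 0)"
        by (rule sum.cong) (use that \<theta>[of _ j s] \<sigma> in auto)
      then show ?thesis using K that by simp
    qed
    show "f \<in> regular V"
      unfolding reg
    proof (rule P.quotients_divide[OF glue_Q[of a] glue_Q[of b]])
      fix x assume "x \<in> ?S"
      then obtain j s where js: "x = \<gamma> (j, s)" "j \<in> K" "s \<in> ?I"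
        unfolding top by auto
      show "(\<Sum>k\<in>K. \<theta> k x * poly (b k) (\<sigma> k x)) \<noteq> 0"
        "f x = (\<Sum>k\<in>K. \<theta> k x * poly (a k) (\<sigma> k x)) / (\<Sum>k\<in>K. \<theta> k x * poly (b k) (\<sigma> k x))"
        unfolding glue[OF js] using ab js by auto
    qed
  qed
  ultimately show ?thesis
    unfolding curve_atlas_def using top by blast
qed

section \<open>Two by two matrices\<close>

definition mat2 :: "'a::zero \<Rightarrow> 'a \<Rightarrow> 'a \<Rightarrow> 'a \<Rightarrow> 'a^2^2" where
  "mat2 a b c d = vector [vector [a, b], vector [c, d]]"

lemma mat2_nth [simp]:
  "mat2 a b c d $ 1 $ 1 = a" "mat2 a b c d $ 1 $ 2 = b"
  "mat2 a b c d $ 2 $ 1 = c" "mat2 a b c d $ 2 $ 2 = d"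
  by (simp_all add: mat2_def)

lemma mat2_eq_iff:
  "A = B \<longleftrightarrow> A $ 1 $ 1 = B $ 1 $ 1 \<and> A $ 1 $ 2 = B $ 1 $ 2 \<and> A $ 2 $ 1 = B $ 2 $ 1 \<and> A $ 2 $ 2 = B $ 2 $ 2"
  for A B :: "'a^2^2"
  by (auto simp: vec_eq_iff forall_2)

lemma vec2_eq_iff: "v = w \<longleftrightarrow> v $ 1 = w $ 1 \<and> v $ 2 = w $ 2" for v w :: "'a^2"
  by (simp add: vec_eq_iff forall_2)

lemma mult2_nth:
  "(A ** B) $ i $ j = A $ i $ 1 * B $ 1 $ j + A $ i $ 2 * B $ 2 $ j"
  for A B :: "'a::semiring_1^2^2"
  by (simp add: matrix_matrix_mult_def sum_2)

lemma mult2_vec_nth: "(A *v v) $ i = A $ i $ 1 * v $ 1 + A $ i $ 2 * v $ 2"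
  for A :: "'a::semiring_1^2^2"
  by (simp add: matrix_vector_mult_def sum_2)

lemma trace_2: "trace (A :: 'a::semiring_1^2^2) = A $ 1 $ 1 + A $ 2 $ 2"
  by (simp add: trace_def sum_2)

lemma mat2_one_nth [simp]:
  "(mat 1 :: 'a::semiring_1^2^2) $ 1 $ 1 = 1" "(mat 1 :: 'a^2^2) $ 1 $ 2 = 0"
  "(mat 1 :: 'a^2^2) $ 2 $ 1 = 0" "(mat 1 :: 'a^2^2) $ 2 $ 2 = 1"
  by (simp_all add: mat_def)

text \<open>Cramer's rule for each row of \<open>A - B\<close>, with \<open>bracket v w\<close> as
  the determinant of the basis. Several matrix identities below are checked on eigenvectors this
  way.\<close>

lemma matrix_eq_on_basis:
  fixes A B :: "complex^2^2"
  assumes "bracket v w \<noteq> 0" "A *v v = B *v v" "A *v w = B *v w"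
  shows "A = B"
proof -
  have "A $ i $ 1 = B $ i $ 1 \<and> A $ i $ 2 = B $ i $ 2" for i
  proof -
    let ?x = "A $ i $ 1 - B $ i $ 1" and ?y = "A $ i $ 2 - B $ i $ 2"
    have "?x * v $ 1 + ?y * v $ 2 = 0" "?x * w $ 1 + ?y * w $ 2 = 0"
      using arg_cong[OF assms(2), of "\<lambda>z. z $ i"] arg_cong[OF assms(3), of "\<lambda>z. z $ i"]
      by (simp_all add: mult2_vec_nth algebra_simps)
    moreover have "?x * bracket v w = (?x * v $ 1 + ?y * v $ 2) * w $ 2 - (?x * w $ 1 + ?y * w $ 2) * v $ 2"
      "?y * bracket v w = (?x * w $ 1 + ?y * w $ 2) * v $ 1 - (?x * v $ 1 + ?y * v $ 2) * w $ 1"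
      by (simp_all add: bracket_def algebra_simps)
    ultimately have "?x * bracket v w = 0" "?y * bracket v w = 0" by simp_all
    with assms(1) show ?thesis by simp
  qed
  then show ?thesis by (simp add: mat2_eq_iff)
qed

lemma det_mat2: "det (mat2 a b c d :: 'a::comm_ring_1^2^2) = a * d - b * c"
  by (simp add: det_2)

lemma matrix_mult_left_cancel:
  fixes P :: "'a::field^'n^'n"
  assumes "det P \<noteq> 0" "P ** X = P ** Y"
  shows "X = Y"
proof -
  obtain Q where "Q ** P = mat 1"
    using assms(1) by (metis invertible_det_nz invertible_def)
  then show ?thesis
    using arg_cong[OF assms(2), of "(**) Q"] by (simp add: matrix_mul_assoc)
qed

text \<open>The adjugate: it is the inverse when the determinant is 1, and its entries are those of
  \<open>A\<close> up to order and sign, so inverse letters keep all entries polynomial in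
  \<open>s\<close>.\<close>

definition adj2 :: "complex^2^2 \<Rightarrow> complex^2^2" where
  "adj2 A = mat2 (A $ 2 $ 2) (- A $ 1 $ 2) (- A $ 2 $ 1) (A $ 1 $ 1)"

lemma adj2_inverse:
  assumes "det A = 1"
  shows "A ** adj2 A = mat 1" "adj2 A ** A = mat 1"
  using assms by (simp_all add: mat2_eq_iff mult2_nth adj2_def det_2 algebra_simps)

lemma det_adj2: "det (adj2 A) = det A"
  by (simp add: adj2_def det_2 algebra_simps)

lemma adj2_adj2: "adj2 (adj2 A) = A"
  by (simp add: adj2_def mat2_eq_iff)

lemma adj2_mult: "adj2 (A ** B) = adj2 B ** adj2 A"
  by (simp add: adj2_def mat2_eq_iff mult2_nth algebra_simps)

lemma conj_transpose_nth [simp]: "conj_transpose A $ i $ j = cnj (A $ j $ i)"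
  by (simp add: conj_transpose_def)

text \<open>Both \<open>conj_transpose A\<close> and \<open>adj2 A\<close> invert \<open>A\<close>.
  The equation between them is real-linear in the entries, unlike unitarity itself.\<close>

lemma SU2_iff: "A \<in> carrier SU2 \<longleftrightarrow> det A = 1 \<and> conj_transpose A = adj2 A"
proof -
  have "conj_transpose A = adj2 A" if "det A = 1" "A ** conj_transpose A = mat 1"
  proof -
    have "adj2 A ** (A ** conj_transpose A) = conj_transpose A"
      by (simp add: matrix_mul_assoc adj2_inverse that(1))
    with that(2) show ?thesis by simp
  qed
  then show ?thesis
    by (auto simp: SU2_def adj2_inverse)
qed

lemma SU2_mult: "A \<in> carrier SU2 \<Longrightarrow> B \<in> carrier SU2 \<Longrightarrow> A ** B \<in> carrier SU2"
proof -
  assume A: "A \<in> carrier SU2" and B: "B \<in> carrier SU2"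
  have "conj_transpose (A ** B) = conj_transpose B ** conj_transpose A"
    by (simp add: mat2_eq_iff mult2_nth mult.commute)
  with A B show ?thesis
    by (simp add: SU2_iff det_mul adj2_mult)
qed

lemma SU2_adj2: "A \<in> carrier SU2 \<Longrightarrow> adj2 A \<in> carrier SU2"
proof -
  assume A: "A \<in> carrier SU2"
  have "conj_transpose (adj2 A) = adj2 (conj_transpose A)"
    by (simp add: mat2_eq_iff adj2_def)
  with A show ?thesis
    by (simp add: SU2_iff det_adj2 adj2_adj2)
qed

lemma mat_1_SU2: "mat 1 \<in> carrier SU2"
  by (simp add: SU2_iff mat2_eq_iff adj2_def)

section \<open>Pairs of matrices and representations\<close>

fun eval_letter :: "complex^2^2 \<Rightarrow> complex^2^2 \<Rightarrow> torus_gen \<times> bool \<Rightarrow> complex^2^2" where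
  "eval_letter A B (Gen_x, b) = (if b then A else adj2 A)"
| "eval_letter A B (Gen_y, b) = (if b then B else adj2 B)"

primrec eval_word :: "complex^2^2 \<Rightarrow> complex^2^2 \<Rightarrow> torus_gen gword \<Rightarrow> complex^2^2" where
  "eval_word A B [] = mat 1"
| "eval_word A B (c # w) = eval_letter A B c ** eval_word A B w"

lemma eval_word_append: "eval_word A B (u @ v) = eval_word A B u ** eval_word A B v"
  by (induction u) (simp_all add: matrix_mul_assoc)

lemma eval_word_replicate:
  assumes "eval_letter A B c *v v = l *s v"
  shows "eval_word A B (replicate k c) *v v = l ^ k *s v"
proof (induction k)
  case (Suc k)
  have "eval_word A B (replicate (Suc k) c) *v v = eval_letter A B c *v (eval_word A B (replicate k c) *v v)"
    by (simp add: matrix_vector_mul_assoc)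
  also have "\<dots> = l ^ k *s (l *s v)"
    unfolding Suc.IH vector_scalar_commute assms ..
  finally show ?case
    by (simp add: mult.commute)
qed simp

lemma eval_word_pres_eq:
  assumes "det A = 1" "det B = 1"
    and rel: "eval_word A B (replicate m (Gen_x, True)) = eval_word A B (replicate n (Gen_y, True))"
    and "pres_eq (torus_rels m n) u v"
  shows "eval_word A B u = eval_word A B v"
  using assms(4)
proof (induction rule: pres_eq.induct)
  case (pres_cancel a b)
  show ?case
    by (cases a; cases b) (simp_all add: adj2_inverse assms(1,2))
next
  case (pres_rel u v)
  with rel show ?case
    by (simp add: torus_rels_def)
qed (simp_all add: eval_word_append)

text \<open>Evaluation happens at a chosen word of the class; it is independent of the choice once
  \<open>A\<close> and \<open>B\<close> have determinant 1 and satisfy the relation.\<close>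

definition pair_rep :: "complex^2^2 \<Rightarrow> complex^2^2 \<Rightarrow> torus_gen gword set \<Rightarrow> complex^2^2" where
  "pair_rep A B U = eval_word A B (SOME w. w \<in> U)"

lemma word_class_some: "word_class R (SOME w. w \<in> word_class R u) = word_class R u"
proof -
  have "(SOME w. w \<in> word_class R u) \<in> word_class R u"
    by (rule someI[of _ u]) (simp add: word_class_def pres_refl)
  then show ?thesis
    unfolding word_class_eq_iff by (simp add: word_class_def pres_sym)
qed

lemma carrier_torus_knot_group:
  "carrier (torus_knot_group m n) = range (word_class (torus_rels m n))"
  by (simp add: torus_knot_group_def presented_group_def)

lemma torus_knot_group_mult:
  "word_class (torus_rels m n) u \<otimes>\<^bsub>torus_knot_group m n\<^esub> word_class (torus_rels m n) v =
    word_class (torus_rels m n) (u @ v)"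
  by (simp add: torus_knot_group_def presented_group_mult)

lemma pair_rep_word_class:
  assumes "det A = 1" "det B = 1"
    and "eval_word A B (replicate m (Gen_x, True)) = eval_word A B (replicate n (Gen_y, True))"
  shows "pair_rep A B (word_class (torus_rels m n) w) = eval_word A B w"
  unfolding pair_rep_def
  by (rule eval_word_pres_eq[OF assms]) (simp add: word_class_eq_iff[symmetric] word_class_some)

lemma pair_rep_hom:
  assumes A: "A \<in> carrier SU2" and B: "B \<in> carrier SU2"
    and rel: "eval_word A B (replicate m (Gen_x, True)) = eval_word A B (replicate n (Gen_y, True))"
  shows "pair_rep A B \<in> hom (torus_knot_group m n) SU2"
proof -
  have *: "pair_rep A B (word_class (torus_rels m n) w) = eval_word A B w" for w
    using A B by (intro pair_rep_word_class rel) (simp_all add: SU2_iff)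
  have "eval_letter A B c \<in> carrier SU2" for c
    by (cases "(A, B, c)" rule: eval_letter.cases) (simp_all add: A B SU2_adj2)
  then have "eval_word A B w \<in> carrier SU2" for w
    by (induction w) (simp_all add: mat_1_SU2 SU2_mult)
  then show "pair_rep A B \<in> hom (torus_knot_group m n) SU2"
    unfolding hom_def carrier_torus_knot_group
    by (auto simp: torus_knot_group_mult * eval_word_append) (simp add: SU2_def)
qed

text \<open>Intertwining passes from letters to words by induction. It serves both to derive the
  relation for the normal form and to compare characters.\<close>

lemma hom_eval_word:
  assumes \<rho>: "\<rho> \<in> hom (torus_knot_group m n) SL2C"
    and AB: "det A = 1" "det B = 1"
    and x: "\<rho> (tk_x m n) ** P = P ** A" and y: "\<rho> (tk_y m n) ** P = P ** B"
  shows "\<rho> (word_class (torus_rels m n) w) ** P = P ** eval_word A B w"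
proof -
  define \<sigma> where "\<sigma> w = \<rho> (word_class (torus_rels m n) w)" for w
  have mult: "\<sigma> (u @ v) = \<sigma> u ** \<sigma> v" for u v
    using hom_mult[OF \<rho>, of "word_class (torus_rels m n) u" "word_class (torus_rels m n) v"]
    by (simp add: \<sigma>_def carrier_torus_knot_group torus_knot_group_mult SL2C_def)
  have det: "det (\<sigma> u) = 1" for u
    using hom_in_carrier[OF \<rho>, of "word_class (torus_rels m n) u"]
    by (simp add: \<sigma>_def carrier_torus_knot_group SL2C_def)
  \<comment> \<open>Membership in \<open>hom\<close> only gives multiplicativity; the empty word
    goes to an invertible idempotent, hence to the identity.\<close>
  have one: "\<sigma> [] = mat 1"
  proof -
    have "adj2 (\<sigma> []) ** (\<sigma> [] ** \<sigma> []) = adj2 (\<sigma> []) ** \<sigma> []"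
      using mult[of "[]" "[]"] by simp
    then show ?thesis
      by (simp add: matrix_mul_assoc adj2_inverse det)
  qed
  have pos: "\<sigma> [(g, True)] ** P = P ** eval_letter A B (g, True)" for g
    using x y by (cases g) (simp_all add: \<sigma>_def tk_x_def tk_y_def)
  have letter: "\<sigma> [c] ** P = P ** eval_letter A B c" for c
  proof -
    obtain g b where c: "c = (g, b)" by (cases c)
    let ?X = "eval_letter A B (g, True)"
    have X: "det ?X = 1" "eval_letter A B (g, False) = adj2 ?X"
      using AB by (cases g; simp)+
    \<comment> \<open>For an inverse letter, \<open>?X ** adj2 ?X\<close> is inserted behind
      \<open>P\<close> and \<open>?X\<close> is moved across \<open>P\<close>, where its image meets
      that of the inverse letter.\<close>
    have "\<sigma> [(g, False)] ** P = \<sigma> [(g, False)] ** (P ** (?X ** adj2 ?X))"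
      by (simp add: adj2_inverse X)
    also have "\<dots> = \<sigma> [(g, False)] ** (\<sigma> [(g, True)] ** P) ** adj2 ?X"
      unfolding pos by (simp add: matrix_mul_assoc)
    also have "\<dots> = \<sigma> ([(g, False)] @ [(g, True)]) ** P ** adj2 ?X"
      unfolding mult by (simp add: matrix_mul_assoc)
    also have "\<sigma> ([(g, False)] @ [(g, True)]) = \<sigma> []"
      using pres_cancel[of "torus_rels m n" g False]
      unfolding word_class_eq_iff[symmetric] by (simp add: \<sigma>_def)
    finally have "\<sigma> [(g, False)] ** P = P ** eval_letter A B (g, False)"
      by (simp add: one X)
    with pos[of g] show ?thesis
      unfolding c by (cases b) simp_all
  qed
  have "\<sigma> w ** P = P ** eval_word A B w"
  proof (induction w)
    case (Cons c w)
    have "\<sigma> (c # w) ** P = \<sigma> [c] ** (\<sigma> w ** P)"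
      using mult[of "[c]" w] by (simp add: matrix_mul_assoc)
    also have "\<dots> = P ** (eval_letter A B c ** eval_word A B w)"
      unfolding Cons.IH by (simp add: matrix_mul_assoc letter)
    finally show ?case by simp
  qed (simp add: one)
  then show ?thesis
    by (simp add: \<sigma>_def)
qed

text \<open>Conjugate matrices have the same trace; the intertwining is applied to the very word
  that \<open>pair_rep\<close> chooses in the class.\<close>

lemma rep_character_intertwined:
  assumes \<rho>: "\<rho> \<in> hom (torus_knot_group m n) SL2C"
    and AB: "det A = 1" "det B = 1"
    and "\<rho> (tk_x m n) ** P = P ** A" "\<rho> (tk_y m n) ** P = P ** B" and P: "det P \<noteq> 0"
  shows "rep_character (torus_knot_group m n) \<rho> = rep_character (torus_knot_group m n) (pair_rep A B)"
proof -
  obtain Q where Q: "P ** Q = mat 1" "Q ** P = mat 1"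
    using P by (metis invertible_det_nz invertible_def)
  have "trace (\<rho> U) = trace (pair_rep A B U)" if U: "U \<in> carrier (torus_knot_group m n)" for U
  proof -
    let ?w = "SOME w. w \<in> U"
    have "U = word_class (torus_rels m n) ?w"
      using U word_class_some unfolding carrier_torus_knot_group by blast
    then have *: "\<rho> U ** P = P ** pair_rep A B U"
      unfolding pair_rep_def using hom_eval_word[OF assms(1-5), of ?w] by simp
    have "trace (\<rho> U) = trace (\<rho> U ** P ** Q)"
      by (simp add: matrix_mul_assoc[symmetric] Q)
    also have "\<dots> = trace (Q ** (P ** pair_rep A B U))"
      unfolding * by (rule trace_mul_sym)
    also have "\<dots> = trace (pair_rep A B U)"
      by (simp add: matrix_mul_assoc Q)
    finally show ?thesis .
  qed
  then show ?thesis
    unfolding rep_character_def by (intro restrict_ext)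
qed

section \<open>The normal form of a pair\<close>

definition diag_mat :: "complex \<Rightarrow> complex^2^2" where
  "diag_mat l = mat2 l 0 0 (inverse l)"

text \<open>
  The matrix with eigenvectors \<open>(1, 1)\<close> and \<open>(s - 1, s)\<close> for the eigenvalues \<open>u\<close> and
  \<open>inverse u\<close>; with respect to the coordinate axes these have cross ratio \<open>(s - 1) / s\<close>.
\<close>

definition norm_mat :: "complex \<Rightarrow> real \<Rightarrow> complex^2^2" where
  "norm_mat u s =
    mat2 (s * u + (1 - s) * inverse u) ((1 - s) * (u - inverse u))
      (s * (u - inverse u)) ((1 - s) * u + s * inverse u)"

lemma det_diag_mat: "l \<noteq> 0 \<Longrightarrow> det (diag_mat l) = 1"
  by (simp add: diag_mat_def det_2)

lemma det_norm_mat: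
  assumes "u \<noteq> 0" shows "det (norm_mat u s) = 1"
proof -
  have "det (norm_mat u s) = u * inverse u * (of_real s + (1 - of_real s)) ^ 2"
    by (simp add: norm_mat_def det_2 algebra_simps power2_eq_square)
  with assms show ?thesis by simp
qed

lemma diag_mat_eigen:
  "diag_mat l *v vector [1, 0] = l *s vector [1, 0]"
  "diag_mat l *v vector [0, 1] = inverse l *s vector [0, 1]"
  by (simp_all add: diag_mat_def vec2_eq_iff mult2_vec_nth)

lemma norm_mat_eigen:
  "norm_mat u s *v vector [1, 1] = u *s vector [1, 1]"
  "norm_mat u s *v vector [of_real s - 1, of_real s] = inverse u *s vector [of_real s - 1, of_real s]"
  by (simp_all add: norm_mat_def vec2_eq_iff mult2_vec_nth algebra_simps)

lemma pair_normal_form: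
  assumes A: "A *v e1 = l *s e1" "A *v e2 = inverse l *s e2"
    and B: "B *v f1 = u *s f1" "B *v f2 = inverse u *s f2"
    and nz: "bracket e1 e2 \<noteq> 0" "bracket e1 f1 \<noteq> 0" "bracket e1 f2 \<noteq> 0" "bracket e2 f1 \<noteq> 0"
    and s: "s \<noteq> 0" "cross_ratio e1 e2 f1 f2 = of_real (1 - 1 / s)"
  obtains P where "det P \<noteq> 0" "A ** P = P ** diag_mat l" "B ** P = P ** norm_mat u s"
proof -
  \<comment> \<open>Cramer's rule gives \<open>bracket e1 e2 *s f1 = ?a *s e1 + ?c *s e2\<close>.
    With the columns scaled in this way, \<open>P\<close> sends \<open>(1, 1)\<close> to the line of
    \<open>f1\<close>.\<close>
  let ?a = "- bracket e2 f1" and ?c = "bracket e1 f1"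
  define P where "P = mat2 (?a * e1 $ 1) (?c * e2 $ 1) (?a * e1 $ 2) (?c * e2 $ 2)"
  have P: "P *v vector [x, y] = (x * ?a) *s e1 + (y * ?c) *s e2" for x y
    by (simp add: P_def vec2_eq_iff mult2_vec_nth algebra_simps)
  have Px: "P *v vector [1, 0] = ?a *s e1" "P *v vector [0, 1] = ?c *s e2"
    by (simp_all add: P vec2_eq_iff)
  have "det P = ?a * ?c * bracket e1 e2"
    by (simp add: P_def det_2 bracket_def algebra_simps)
  then have "det P \<noteq> 0"
    using nz by simp
  have P1: "P *v vector [1, 1] = bracket e1 e2 *s f1"
    by (simp add: P vec2_eq_iff bracket_def algebra_simps)
  have "s * (?c * bracket e2 f2) = (s - 1) * (bracket e1 f2 * bracket e2 f1)"
    using s nz by (simp add: cross_ratio_def field_simps)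
  then have *: "(s - 1) * ?a * bracket e1 f2 = - s * ?c * bracket e2 f2"
    by (simp add: algebra_simps)
  \<comment> \<open>The cross ratio fixes the second eigenline: the preceding equation makes the
    coefficients of \<open>e1\<close> and \<open>e2\<close> proportional to those in the Cramer
    expansion of \<open>f2\<close>.\<close>
  have P2: "bracket e1 f2 *s (P *v vector [of_real s - 1, of_real s]) = (s * ?c * bracket e1 e2) *s f2"
  proof -
    have "bracket e1 f2 *s (P *v vector [of_real s - 1, of_real s]) =
        ((s - 1) * ?a * bracket e1 f2) *s e1 + (s * ?c * bracket e1 f2) *s e2"
      by (simp add: P vec2_eq_iff algebra_simps)
    also have "\<dots> = (s * ?c * bracket e1 e2) *s f2"
      unfolding * by (simp add: vec2_eq_iff bracket_def algebra_simps)
    finally show ?thesis .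
  qed
  have "A ** P = P ** diag_mat l"
  proof (rule matrix_eq_on_basis[of "vector [1, 0]" "vector [0, 1]"])
    show "A ** P *v vector [1, 0] = P ** diag_mat l *v vector [1, 0]"
      "A ** P *v vector [0, 1] = P ** diag_mat l *v vector [0, 1]"
      unfolding matrix_vector_mul_assoc[symmetric] diag_mat_eigen vector_scalar_commute Px A
      by (simp_all add: mult.commute)
  qed (simp add: bracket_def)
  moreover have "B ** P = P ** norm_mat u s"
  proof (rule matrix_eq_on_basis[of "vector [1, 1]" "vector [of_real s - 1, of_real s]"])
    show "B ** P *v vector [1, 1] = P ** norm_mat u s *v vector [1, 1]"
      unfolding matrix_vector_mul_assoc[symmetric] norm_mat_eigen vector_scalar_commute P1 B
      by (simp add: mult.commute)
    have "bracket e1 f2 *s (B *v (P *v vector [of_real s - 1, of_real s])) =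
        B *v (bracket e1 f2 *s (P *v vector [of_real s - 1, of_real s]))"
      by (rule vector_scalar_commute[symmetric])
    also have "\<dots> = inverse u *s ((s * ?c * bracket e1 e2) *s f2)"
      unfolding P2 vector_scalar_commute B by (simp only: vector_smult_assoc mult.commute)
    also have "\<dots> = bracket e1 f2 *s (inverse u *s (P *v vector [of_real s - 1, of_real s]))"
      unfolding P2[symmetric] by (simp only: vector_smult_assoc mult.commute)
    finally have "bracket e1 f2 *s (B *v (P *v vector [of_real s - 1, of_real s])) =
        bracket e1 f2 *s (inverse u *s (P *v vector [of_real s - 1, of_real s]))" .
    then have "B *v (P *v vector [of_real s - 1, of_real s]) = inverse u *s (P *v vector [of_real s - 1, of_real s])"
      using nz(3) by (simp add: vec2_eq_iff)
    then show "B ** P *v vector [of_real s - 1, of_real s] = P ** norm_mat u s *v vector [of_real s - 1, of_real s]"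
      unfolding matrix_vector_mul_assoc[symmetric] norm_mat_eigen vector_scalar_commute .
  qed (simp add: bracket_def)
  ultimately show ?thesis
    using \<open>det P \<noteq> 0\<close> that by blast
qed

section \<open>Eigenlines of special unitary matrices\<close>

text \<open>The antilinear map commuting with \<open>SU(2)\<close>; \<open>orth v\<close> spans the orthogonal complement of \<open>v\<close>.\<close>

definition orth :: "complex^2 \<Rightarrow> complex^2" where
  "orth v = vector [- cnj (v $ 2), cnj (v $ 1)]"

lemma orth_nth [simp]: "orth v $ 1 = - cnj (v $ 2)" "orth v $ 2 = cnj (v $ 1)"
  by (simp_all add: orth_def)

lemma orth_eq_0_iff: "orth v = 0 \<longleftrightarrow> v = 0"
  by (auto simp: vec2_eq_iff)

lemma orth_orth: "orth (orth v) = (- 1) *s v"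
  by (simp add: vec2_eq_iff)

lemma orth_scale: "orth (c *s v) = cnj c *s orth v"
  by (simp add: vec2_eq_iff)

lemma bracket_orth_self: "v \<noteq> 0 \<Longrightarrow> bracket v (orth v) \<noteq> 0"
proof
  assume "v \<noteq> 0" and "bracket v (orth v) = 0"
  then have "of_real ((cmod (v $ 1))\<^sup>2 + (cmod (v $ 2))\<^sup>2) = (0 :: complex)"
    by (simp add: bracket_def complex_norm_square del: of_real_power)
  then have "(cmod (v $ 1))\<^sup>2 + (cmod (v $ 2))\<^sup>2 = 0"
    by (simp only: of_real_eq_0_iff)
  with \<open>v \<noteq> 0\<close> show False
    by (simp add: vec2_eq_iff sum_power2_eq_zero_iff)
qed

lemma bracket_orth_orth: "bracket (orth v) (orth w) = cnj (bracket v w)"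
  by (simp add: bracket_def algebra_simps)

lemma bracket_orth_left: "bracket (orth v) w = - cnj (bracket v (orth w))"
  by (simp add: bracket_def algebra_simps)

text \<open>Up to sign, numerator and denominator are each a number times its conjugate; the sign
  comes from \<open>bracket_orth_left\<close> and is the source of \<open>r < 0\<close>.\<close>

lemma cross_ratio_orth:
  "cross_ratio v (orth v) w (orth w) =
    of_real (- ((cmod (bracket v w))\<^sup>2 / (cmod (bracket v (orth w)))\<^sup>2))"
  unfolding cross_ratio_def bracket_orth_orth bracket_orth_left[of v w]
  by (simp add: complex_norm_square del: of_real_power)

text \<open>If the first row of \<open>A\<close> is \<open>(a, b)\<close>, the condition
  \<open>conj_transpose A = adj2 A\<close> makes the second row \<open>(- cnj b, cnj a)\<close>,
  which is commutation with the quaternionic structure \<open>orth\<close>. Hence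
  \<open>orth v\<close> is an eigenvector whenever \<open>v\<close> is one.\<close>

lemma SU2_orth:
  assumes "A \<in> carrier SU2"
  shows "A *v orth v = orth (A *v v)"
proof -
  have "\<And>i j. cnj (A $ j $ i) = adj2 A $ i $ j"
    using assms by (metis SU2_iff conj_transpose_nth)
  from this[of 1 1] this[of 2 1] this[of 1 2] this[of 2 2] show ?thesis
    by (simp add: vec2_eq_iff mult2_vec_nth adj2_def)
qed

lemma bracket_mult: "bracket (A *v v) (A *v w) = det A * bracket v w"
  by (simp add: bracket_def det_2 mult2_vec_nth algebra_simps)

lemma bracket_scale: "bracket (a *s v) (b *s w) = a * b * bracket v w"
  by (simp add: bracket_def algebra_simps)

lemma bracket_eq_0E:
  assumes "bracket v w = 0" "v \<noteq> 0"
  obtains c where "w = c *s v"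
proof (cases "v $ 1 = 0")
  case True
  with assms have "w = (w $ 2 / v $ 2) *s v"
    by (auto simp: vec2_eq_iff bracket_def)
  then show ?thesis by (rule that)
next
  case False
  with assms have "w = (w $ 1 / v $ 1) *s v"
    by (auto simp: vec2_eq_iff bracket_def field_simps)
  then show ?thesis by (rule that)
qed

lemma eigenvector_exists:
  fixes A :: "complex^2^2"
  obtains l v where "has_eigenvector A l v"
proof -
  let ?a = "A $ 1 $ 1" and ?b = "A $ 1 $ 2" and ?c = "A $ 2 $ 1" and ?d = "A $ 2 $ 2"
  let ?D = "csqrt ((?a - ?d)\<^sup>2 + 4 * ?b * ?c)"
  define l where "l = (?a + ?d + ?D) / 2"
  have "?D\<^sup>2 = (?a - ?d)\<^sup>2 + 4 * ?b * ?c"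
    by simp
  moreover have "?D = 2 * l - ?a - ?d"
    by (simp add: l_def field_simps)
  ultimately have "(2 * l - ?a - ?d)\<^sup>2 = (?a - ?d)\<^sup>2 + 4 * ?b * ?c"
    by (simp only:)
  then have "4 * ((l - ?a) * (l - ?d)) = 4 * (?b * ?c)"
    by (simp add: power2_eq_square algebra_simps)
  then have root: "(l - ?a) * (l - ?d) = ?b * ?c"
    by simp
  show ?thesis
  \<comment> \<open>The vector \<open>(?b, l - ?a)\<close> is an eigenvector unless it vanishes; in
    that case \<open>A\<close> is lower triangular and preserves the second axis.\<close>
  proof (cases "?b = 0 \<and> l = ?a")
    case True
    then have "has_eigenvector A ?d (vector [0, 1])"
      by (simp add: has_eigenvector_def vec2_eq_iff mult2_vec_nth)
    then show ?thesis by (rule that)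
  next
    case False
    then have "has_eigenvector A l (vector [?b, l - ?a])"
      using root by (auto simp: has_eigenvector_def vec2_eq_iff mult2_vec_nth algebra_simps)
    then show ?thesis by (rule that)
  qed
qed

lemma has_eigenvector_scale:
  "has_eigenvector A l v \<Longrightarrow> c \<noteq> 0 \<Longrightarrow> has_eigenvector A l (c *s v)"
  by (auto simp: has_eigenvector_def vector_scalar_commute mult.commute)

lemma SU2_eigenlines:
  assumes A: "A \<in> carrier SU2"
  obtains l v where "has_eigenvector A l v" "has_eigenvector A (inverse l) (orth v)"
    "cmod l = 1" "Im l \<ge> 0"
proof -
  obtain l v where v: "has_eigenvector A l v"
    by (rule eigenvector_exists)
  then have orth_v: "A *v orth v = cnj l *s orth v" and nz: "v \<noteq> 0"
    by (simp_all add: has_eigenvector_def SU2_orth[OF A] orth_scale)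
  \<comment> \<open>Applying \<open>A\<close> multiplies the bracket by \<open>det A = 1\<close>,
    which forces the product of the two eigenvalues to be 1.\<close>
  have "l * cnj l * bracket v (orth v) = 1 * bracket v (orth v)"
    using bracket_mult[of A v "orth v"] v A
    by (simp add: orth_v has_eigenvector_def bracket_scale SU2_iff)
  then have 1: "l * cnj l = 1"
    using bracket_orth_self[OF nz] by simp
  then have cnj: "cnj l = inverse l"
    by (metis inverse_unique)
  have norm: "cmod l = 1"
    using 1 by (metis cmod_eq_Re complex_mod_cnj complex_mod_mult_cnj norm_one norm_power real_sqrt_abs
        abs_norm_cancel real_sqrt_one)
  have orth: "has_eigenvector A (inverse l) (orth v)"
    using orth_v nz by (simp add: has_eigenvector_def cnj orth_eq_0_iff)
  show ?thesis
  proof (cases "Im l \<ge> 0")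
    case True
    then show ?thesis using that v orth norm by blast
  next
    case False
    \<comment> \<open>Interchanging the two eigenlines moves the eigenvalue to the upper half plane;
      \<open>orth\<close> applied twice is only a sign.\<close>
    have "has_eigenvector A (inverse (inverse l)) (orth (orth v))"
      unfolding orth_orth inverse_inverse_eq by (rule has_eigenvector_scale[OF v]) simp
    moreover have "Im (inverse l) \<ge> 0" "cmod (inverse l) = 1"
      using False norm by (simp_all add: cnj[symmetric])
    ultimately show ?thesis using that orth by blast
  qed
qed

lemma has_eigenvector_scalar:
  assumes "has_eigenvector A l v" "has_eigenvector A l w" "bracket v w \<noteq> 0" "x \<noteq> 0"
  shows "has_eigenvector A l x"
proof -
  have *: "mat2 l 0 0 l *v x = l *s x" for x
    by (simp add: vec2_eq_iff mult2_vec_nth)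
  have "A = mat2 l 0 0 l"
    using assms by (intro matrix_eq_on_basis[OF assms(3)]) (simp_all add: has_eigenvector_def *)
  then show ?thesis
    using assms(4) by (simp add: has_eigenvector_def *)
qed

lemma norm_1_Im_0: "cmod l = 1 \<Longrightarrow> Im l = 0 \<Longrightarrow> inverse l = l"
  using cmod_eq_Re[of l] by (auto simp: complex_eq_iff abs_if split: if_splits)

lemma irreducible_pair_sym: "irreducible_pair A B \<Longrightarrow> irreducible_pair B A"
  unfolding irreducible_pair_def by blast

text \<open>A real eigenvalue of modulus 1 equals its inverse, so \<open>A\<close> would be scalar
  and every eigenvector of \<open>B\<close> would be a common one.\<close>

lemma irreducible_pair_eigenvalue:
  assumes "irreducible_pair A B" "B \<in> carrier SU2"
    and "has_eigenvector A l v" "has_eigenvector A (inverse l) (orth v)" "cmod l = 1"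
  shows "Im l \<noteq> 0"
proof
  assume "Im l = 0"
  with assms have orth: "has_eigenvector A l (orth v)"
    by (simp add: norm_1_Im_0)
  obtain u w where w: "has_eigenvector B u w"
    by (rule eigenvector_exists)
  have "has_eigenvector A l w"
    using assms(3) w
    by (intro has_eigenvector_scalar[OF assms(3) orth] bracket_orth_self)
      (simp_all add: has_eigenvector_def)
  with w assms(1) show False
    unfolding irreducible_pair_def by blast
qed

lemma irreducible_pair_bracket:
  assumes "irreducible_pair A B" "has_eigenvector A l v" "has_eigenvector B u w"
  shows "bracket v w \<noteq> 0"
proof
  assume "bracket v w = 0"
  moreover have "v \<noteq> 0" "w \<noteq> 0"
    using assms by (auto simp: has_eigenvector_def)
  ultimately obtain c where "w = c *s v" "c \<noteq> 0"
    by (metis bracket_eq_0E vector_smult_lzero)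
  with assms show False
    unfolding irreducible_pair_def by (metis has_eigenvector_scale)
qed

text \<open>Since \<open>A\<close> preserves the bracket, \<open>bracket e1 v\<close> can be nonzero
  only if \<open>k = inverse l\<close>, and \<open>bracket e2 v\<close> only if
  \<open>k = l\<close>; these exclude each other, so \<open>v\<close> lies on one of the two
  lines.\<close>

lemma has_eigenvector_cases:
  assumes det: "det A = 1" and e: "has_eigenvector A l e1" "has_eigenvector A (inverse l) e2"
    and l: "l \<noteq> inverse l" "l \<noteq> 0" and nz: "bracket e1 e2 \<noteq> 0" and v: "has_eigenvector A k v"
  obtains c where "k = l" "c \<noteq> 0" "v = c *s e1" | c where "k = inverse l" "c \<noteq> 0" "v = c *s e2"
proof -
  have 1: "(k * l) * bracket e1 v = bracket e1 v"
    using bracket_mult[of A e1 v] e v det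
    by (simp add: has_eigenvector_def bracket_scale mult.commute)
  have 2: "(k * inverse l) * bracket e2 v = bracket e2 v"
    using bracket_mult[of A e2 v] e v det
    by (simp add: has_eigenvector_def bracket_scale mult.commute)
  have nz': "e1 \<noteq> 0" "e2 \<noteq> 0" "v \<noteq> 0"
    using e v by (auto simp: has_eigenvector_def)
  show ?thesis
  proof (cases "bracket e1 v = 0")
    case True
    then obtain c where c: "v = c *s e1"
      using nz' by (metis bracket_eq_0E)
    with nz' have "c \<noteq> 0" by auto
    have "bracket e2 v = - c * bracket e1 e2"
      by (simp add: c bracket_def algebra_simps)
    with 2 nz \<open>c \<noteq> 0\<close> l have "k = l"
      by (simp add: field_simps)
    with c \<open>c \<noteq> 0\<close> show ?thesis by (intro that(1))
  next
    case False
    with 1 have k: "k = inverse l"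
      using l by (simp add: field_simps)
    have "bracket e2 v = 0"
    proof (rule ccontr)
      assume "bracket e2 v \<noteq> 0"
      with 2 have "k = l" using l by (simp add: field_simps)
      with k l show False by simp
    qed
    then obtain c where "v = c *s e2"
      using nz' by (metis bracket_eq_0E)
    with nz' k show ?thesis by (intro that(2)) auto
  qed
qed

lemma cross_ratio_swap:
  "cross_ratio e2 e1 f1 f2 = inverse (cross_ratio e1 e2 f1 f2)"
  "cross_ratio e1 e2 f2 f1 = inverse (cross_ratio e1 e2 f1 f2)"
  by (simp_all add: cross_ratio_def mult.commute)

text \<open>The eigenlines are determined up to order and the cross ratio ignores scaling, so only
  the four orderings remain; an exchange in one pair inverts the cross ratio.\<close>

lemma triples_of_eq:
  assumes det: "det A = 1" "det B = 1"
    and A: "has_eigenvector A l e1" "has_eigenvector A (inverse l) e2"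
    and B: "has_eigenvector B u f1" "has_eigenvector B (inverse u) f2"
    and lu: "l \<noteq> inverse l" "l \<noteq> 0" "u \<noteq> inverse u" "u \<noteq> 0"
    and nz: "bracket e1 e2 \<noteq> 0" "bracket f1 f2 \<noteq> 0"
    and r: "cross_ratio e1 e2 f1 f2 = of_real r"
  shows "triples_of A B =
    {(l, u, r), (l, inverse u, inverse r), (inverse l, u, inverse r), (inverse l, inverse u, r)}"
    (is "_ = ?T")
proof
  have r': "cross_ratio e1 e2 f2 f1 = of_real (inverse r)" "cross_ratio e2 e1 f1 f2 = of_real (inverse r)"
      "cross_ratio e2 e1 f2 f1 = of_real r"
    using r by (simp_all add: cross_ratio_swap[of e2 e1] cross_ratio_swap(2)[of e1 e2 f2 f1])
  have "(l, u, r) \<in> triples_of A B" "(l, inverse u, inverse r) \<in> triples_of A B"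
      "(inverse l, u, inverse r) \<in> triples_of A B" "(inverse l, inverse u, r) \<in> triples_of A B"
    unfolding triples_of_def mem_Collect_eq prod.case inverse_inverse_eq
    using A B r r' by blast+
  then show "?T \<subseteq> triples_of A B" by simp
  show "triples_of A B \<subseteq> ?T"
  proof
    fix t assume "t \<in> triples_of A B"
    then obtain k j q e1' e2' f1' f2' where t: "t = (k, j, q)"
      and A': "has_eigenvector A k e1'" "has_eigenvector A (inverse k) e2'"
      and B': "has_eigenvector B j f1'" "has_eigenvector B (inverse j) f2'"
      and q: "cross_ratio e1' e2' f1' f2' = of_real q"
      unfolding triples_of_def by auto
    note A_cases = has_eigenvector_cases[OF det(1) A lu(1,2) nz(1)]
    note B_cases = has_eigenvector_cases[OF det(2) B lu(3,4) nz(2)]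
    have "(\<exists>a b. a \<noteq> 0 \<and> b \<noteq> 0 \<and> k = l \<and> e1' = a *s e1 \<and> e2' = b *s e2) \<or>
        (\<exists>a b. a \<noteq> 0 \<and> b \<noteq> 0 \<and> k = inverse l \<and> e1' = a *s e2 \<and> e2' = b *s e1)"
      using lu by (rule_tac A_cases[OF A'(1)]; rule_tac A_cases[OF A'(2)]) auto
    moreover have "(\<exists>a b. a \<noteq> 0 \<and> b \<noteq> 0 \<and> j = u \<and> f1' = a *s f1 \<and> f2' = b *s f2) \<or>
        (\<exists>a b. a \<noteq> 0 \<and> b \<noteq> 0 \<and> j = inverse u \<and> f1' = a *s f2 \<and> f2' = b *s f1)"
      using lu by (rule_tac B_cases[OF B'(1)]; rule_tac B_cases[OF B'(2)]) auto
    ultimately show "t \<in> ?T"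
      unfolding t using q
      by (elim disjE exE conjE)
        (simp_all only: cross_ratio_scale r r' of_real_eq_iff insert_iff prod.inject simp_thms)
  qed
qed

section \<open>Irreducible representations\<close>

text \<open>On the unit circle inversion is complex conjugation, so the upper half planes select one
  member of each orbit of eigenvalue pairs.\<close>

definition spectra :: "nat \<Rightarrow> nat \<Rightarrow> (complex \<times> complex) set" where
  "spectra m n = {(l, u). l ^ m = u ^ n \<and> l ^ m \<in> {1, -1} \<and> Im l > 0 \<and> Im u > 0}"

lemma spectraD:
  assumes "(l, u) \<in> spectra m n"
  shows "l ^ m = u ^ n" "l ^ m \<in> {1, -1}" "u ^ n \<in> {1, -1}" "Im l > 0" "Im u > 0"
  using assms unfolding spectra_def by auto

fun curve_param :: "nat \<Rightarrow> nat \<Rightarrow> (complex \<times> complex) \<times> real \<Rightarrow> (complex \<times> complex \<times> real) set" where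
  "curve_param m n ((l, u), s) = orbit Z2_Z2 (Z2_Z2_action m n) (l, u, 1 - 1 / s)"

fun curve_char :: "nat \<Rightarrow> nat \<Rightarrow> (complex \<times> complex) \<times> real \<Rightarrow> torus_gen gword set \<Rightarrow> complex" where
  "curve_char m n ((l, u), s) =
    rep_character (torus_knot_group m n) (pair_rep (diag_mat l) (norm_mat u s))"

lemma norm_root_pm1:
  assumes "0 < k" "l ^ k \<in> {1, -1 :: complex}"
  shows "cmod l = 1"
proof -
  have "cmod l ^ k = 1"
    using assms(2) by (auto simp flip: norm_power)
  with assms(1) show ?thesis
    using power_eq_imp_eq_base[of "cmod l" k 1] by simp
qed

lemma spectra_norm:
  assumes "0 < m" "0 < n" "(l, u) \<in> spectra m n"
  shows "cmod l = 1" "cmod u = 1"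
  using assms norm_root_pm1[of m l] norm_root_pm1[of n u] by (auto simp: spectra_def)

lemma inverse_eq_cnj: "cmod l = 1 \<Longrightarrow> inverse l = cnj l"
  by (metis complex_norm_square inverse_unique of_real_1 one_power2)

lemma neq_inverse_of_Im_pos:
  assumes "cmod l = 1" "Im l > 0"
  shows "l \<noteq> inverse l" "l \<noteq> 0"
  using assms by (auto simp: inverse_eq_cnj complex_eq_iff)

lemma spectra_param_set:
  assumes "(l, u) \<in> spectra m n" "0 < s" "s < 1"
  shows "(l, u, 1 - 1 / s) \<in> param_set m n"
proof -
  have "Im l > 0" "Im u > 0"
    using assms(1) by (simp_all add: spectra_def)
  then have "l \<noteq> 1" "l \<noteq> -1" "u \<noteq> 1" "u \<noteq> -1" by auto
  then show ?thesis
    using assms(2,3) spectraD(1,3)[OF assms(1)] by (simp add: param_set_def)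
qed

lemma orbit_param_set:
  assumes "t \<in> param_set m n"
  shows "orbit Z2_Z2 (Z2_Z2_action m n) t = {t, swap_f t, swap_e t, swap_e (swap_f t)}"
proof -
  have "orbit Z2_Z2 (Z2_Z2_action m n) t = (\<lambda>g. Z2_Z2_action m n g t) ` carrier Z2_Z2"
    by (auto simp: orbit_def)
  with assms show ?thesis
    unfolding carrier_Z2_Z2 by (simp add: Z2_Z2_action_def)
qed

lemma normal_form_power:
  "eval_word (diag_mat l) B (replicate k (Gen_x, True)) *v vector [1, 0] = l ^ k *s vector [1, 0]"
  "eval_word (diag_mat l) B (replicate k (Gen_x, True)) *v vector [0, 1] = inverse l ^ k *s vector [0, 1]"
  "eval_word A (norm_mat u s) (replicate k (Gen_y, True)) *v vector [1, 1] = u ^ k *s vector [1, 1]"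
  "eval_word A (norm_mat u s) (replicate k (Gen_y, True)) *v vector [of_real s - 1, of_real s] =
    inverse u ^ k *s vector [of_real s - 1, of_real s]"
  by (rule eval_word_replicate, simp add: diag_mat_eigen norm_mat_eigen)+

text \<open>The vector \<open>(1, 1)\<close> is an eigenvector of the power of
  \<open>norm_mat u s\<close> and the sum of the two axis eigenvectors of the power of
  \<open>diag_mat l\<close>; equal powers force
  \<open>l ^ m = inverse l ^ m = u ^ n\<close>.\<close>

lemma normal_form_relation:
  assumes "eval_word (diag_mat l) (norm_mat u s) (replicate m (Gen_x, True)) =
      eval_word (diag_mat l) (norm_mat u s) (replicate n (Gen_y, True))" and "l \<noteq> 0"
  shows "l ^ m = u ^ n" "l ^ m \<in> {1, -1}"
proof -
  have sum: "vector [1, 1] = vector [1, 0] + (vector [0, 1] :: complex^2)"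
    by (simp add: vec2_eq_iff)
  let ?E = "eval_word (diag_mat l) (norm_mat u s)"
  have "?E (replicate m (Gen_x, True)) *v vector [1, 1] =
      l ^ m *s vector [1, 0] + inverse l ^ m *s vector [0, 1]"
    unfolding sum matrix_vector_right_distrib normal_form_power ..
  then have "u ^ n = l ^ m \<and> u ^ n = inverse l ^ m"
    unfolding assms(1) normal_form_power by (auto simp: vec2_eq_iff)
  then have *: "l ^ m = u ^ n" "inverse l ^ m = u ^ n"
    by metis+
  then show "l ^ m = u ^ n" by simp
  have "l ^ m = inverse (l ^ m)"
    using * by (metis power_inverse)
  then have "(l ^ m - 1) * (l ^ m + 1) = 0"
    using \<open>l \<noteq> 0\<close> by (simp add: field_simps)
  then show "l ^ m \<in> {1, -1}"
    by (auto simp: eq_neg_iff_add_eq_0)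
qed

text \<open>If \<open>l ^ k\<close> is 1 or -1, it is its own inverse, so both eigenlines carry the
  same eigenvalue of the power.\<close>

lemma eval_word_replicate_scalar:
  assumes "eval_letter A B c *v v = l *s v" "eval_letter A B c *v w = inverse l *s w"
    and "bracket v w \<noteq> 0" and "l ^ k \<in> {1, -1}"
  shows "eval_word A B (replicate k c) = mat2 (l ^ k) 0 0 (l ^ k)"
proof -
  have scalar: "mat2 a 0 0 a *v x = a *s x" for a :: complex and x
    by (simp add: vec2_eq_iff mult2_vec_nth)
  have "inverse l ^ k = l ^ k"
    using assms(4) by (auto simp: power_inverse)
  then show ?thesis
    using assms(3) by (intro matrix_eq_on_basis[of v w])
      (simp_all only: not_False_eq_True scalar eval_word_replicate[OF assms(1)] eval_word_replicate[OF assms(2)])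
qed

lemma SU2_subset_SL2C: "hom G SU2 \<subseteq> hom G SL2C"
  unfolding hom_def SU2_def SL2C_def by auto

text \<open>The same \<open>k\<close> and \<open>s\<close> describe the character and the set of
  triples. This link lets a map defined on characters through their parameters be recognized as the
  assignment of triples.\<close>

proposition irred_SU2_rep_normal_form:
  assumes mn: "0 < m" "0 < n" and \<rho>: "\<rho> \<in> irred_SU2_reps m n"
  obtains k s where "k \<in> spectra m n" "0 < s" "s < 1"
    "rep_character (torus_knot_group m n) \<rho> = curve_char m n (k, s)"
    "triples_of (\<rho> (tk_x m n)) (\<rho> (tk_y m n)) = curve_param m n (k, s)"
proof -
  let ?A = "\<rho> (tk_x m n)" and ?B = "\<rho> (tk_y m n)"
  have hom: "\<rho> \<in> hom (torus_knot_group m n) SU2" and irr: "irreducible_pair ?A ?B"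
    using \<rho> by (simp_all add: irred_SU2_reps_def)
  then have hom': "\<rho> \<in> hom (torus_knot_group m n) SL2C"
    using SU2_subset_SL2C by blast
  have A: "?A \<in> carrier SU2" and B: "?B \<in> carrier SU2"
    by (rule hom_in_carrier[OF hom]; simp add: carrier_torus_knot_group tk_x_def tk_y_def)+
  obtain l e where e: "has_eigenvector ?A l e" "has_eigenvector ?A (inverse l) (orth e)"
      and l: "cmod l = 1" "Im l \<ge> 0"
    by (rule SU2_eigenlines[OF A])
  obtain u f where f: "has_eigenvector ?B u f" "has_eigenvector ?B (inverse u) (orth f)"
      and u: "cmod u = 1" "Im u \<ge> 0"
    by (rule SU2_eigenlines[OF B])
  have Im: "Im l > 0" "Im u > 0"
    using irreducible_pair_eigenvalue[OF irr B e l(1)] l(2)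
      irreducible_pair_eigenvalue[OF irreducible_pair_sym[OF irr] A f u(1)] u(2) by auto
  note l' = neq_inverse_of_Im_pos[OF l(1) Im(1)] and u' = neq_inverse_of_Im_pos[OF u(1) Im(2)]
  have nz: "bracket e (orth e) \<noteq> 0" "bracket f (orth f) \<noteq> 0"
    using e f by (auto simp: has_eigenvector_def intro!: bracket_orth_self)
  have nz': "bracket e f \<noteq> 0" "bracket e (orth f) \<noteq> 0"
    using irreducible_pair_bracket[OF irr] e f by blast+
  define p where "p = (cmod (bracket e (orth f)))\<^sup>2"
  define q where "q = (cmod (bracket e f))\<^sup>2"
  \<comment> \<open>Here \<open>p\<close> is the squared modulus of the Hermitian product of
    \<open>e\<close> and \<open>f\<close>, and \<open>p + q\<close> is the product of their squared
    norms; thus \<open>s\<close> is the squared cosine of the angle between the two lines.\<close>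
  define s where "s = p / (p + q)"
  have pq: "0 < p" "0 < q"
    using nz' by (simp_all add: p_def q_def)
  then have s: "0 < s" "s < 1" and r: "1 - 1 / s = - (q / p)"
    by (simp_all add: s_def field_simps)
  have cr: "cross_ratio e (orth e) f (orth f) = of_real (1 - 1 / s)"
    unfolding r cross_ratio_orth p_def q_def ..
  obtain P where P: "det P \<noteq> 0" "?A ** P = P ** diag_mat l" "?B ** P = P ** norm_mat u s"
  proof (rule pair_normal_form[where A = ?A and B = ?B and l = l and u = u, OF _ _ _ _ nz(1) nz' _ _ cr])
    show "bracket (orth e) f \<noteq> 0"
      using nz' by (simp add: bracket_orth_left)
  qed (use e f s in \<open>simp_all add: has_eigenvector_def\<close>)
  have det: "det (diag_mat l) = 1" "det (norm_mat u s) = 1"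
    using l' u' by (simp_all add: det_diag_mat det_norm_mat)
  note eval = hom_eval_word[OF hom' det P(2,3)]
  let ?E = "eval_word (diag_mat l) (norm_mat u s)"
  have "P ** ?E (replicate m (Gen_x, True)) = P ** ?E (replicate n (Gen_y, True))"
    unfolding eval[symmetric]
    using pres_rel[of _ _ "torus_rels m n"] unfolding word_class_eq_iff[symmetric]
    by (simp add: torus_rels_def)
  then have "?E (replicate m (Gen_x, True)) = ?E (replicate n (Gen_y, True))"
    by (rule matrix_mult_left_cancel[OF P(1)])
  from normal_form_relation[OF this l'(2)] Im have "(l, u) \<in> spectra m n"
    by (simp add: spectra_def)
  moreover have "rep_character (torus_knot_group m n) \<rho> = curve_char m n ((l, u), s)"
    using rep_character_intertwined[OF hom' det P(2,3,1)] by simp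
  moreover have "triples_of ?A ?B = curve_param m n ((l, u), s)"
    using triples_of_eq[OF _ _ e f l'(1,2) u'(1,2) nz cr] A B
      orbit_param_set[OF spectra_param_set[OF calculation(1) s]]
    by (simp add: SU2_iff)
  ultimately show ?thesis
    using that s by blast
qed

text \<open>For \<open>0 < s < 1\<close> this is the conjugate of \<open>norm_mat u s\<close> by the
  diagonal matrix with entries \<open>sqrt s\<close> and \<open>sqrt (1 - s)\<close>. The
  conjugation fixes \<open>diag_mat l\<close> and makes the eigenlines of the other matrix
  orthogonal, spanned by \<open>(a, b)\<close> and \<open>(- b, a)\<close>.\<close>

definition unitary_mat :: "complex \<Rightarrow> real \<Rightarrow> complex^2^2" where
  "unitary_mat u s =
    (let a = complex_of_real (sqrt s); b = complex_of_real (sqrt (1 - s))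
     in mat2 (a * a * u + b * b * inverse u) (a * b * (u - inverse u))
          (a * b * (u - inverse u)) (b * b * u + a * a * inverse u))"

lemma curve_char_in_Y_irr:
  assumes mn: "0 < m" "0 < n" and lu: "(l, u) \<in> spectra m n" and s: "0 < s" "s < 1"
  shows "curve_char m n ((l, u), s) \<in> Y_irr m n"
proof -
  have norm: "cmod l = 1" "cmod u = 1"
    using spectra_norm[OF mn lu] .
  have Im: "Im l > 0" "Im u > 0"
    using lu by (simp_all add: spectra_def)
  note l' = neq_inverse_of_Im_pos[OF norm(1) Im(1)] and u' = neq_inverse_of_Im_pos[OF norm(2) Im(2)]
  let ?A = "diag_mat l" and ?B = "unitary_mat u s"
  define a b where "a = complex_of_real (sqrt s)" and "b = complex_of_real (sqrt (1 - s))"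
  have ab: "a * a = of_real s" "b * b = 1 - of_real s" "a \<noteq> 0" "b \<noteq> 0" "cnj a = a" "cnj b = b"
    using s by (simp_all add: a_def b_def flip: of_real_mult)
  have B: "?B = mat2 (a * a * u + b * b * inverse u) (a * b * (u - inverse u))
      (a * b * (u - inverse u)) (b * b * u + a * a * inverse u)"
    by (simp add: unitary_mat_def Let_def a_def b_def)
  have sum: "a * a + b * b = 1" by (simp add: ab)
  have eigen: "?B *v vector [a, b] = u *s vector [a, b]"
    "?B *v vector [- b, a] = inverse u *s vector [- b, a]"
  proof -
    have "?B *v vector [a, b] = (a * a + b * b) *s (u *s vector [a, b])"
      "?B *v vector [- b, a] = (a * a + b * b) *s (inverse u *s vector [- b, a])"
      unfolding B by (simp_all add: vec2_eq_iff mult2_vec_nth algebra_simps)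
    then show "?B *v vector [a, b] = u *s vector [a, b]"
      "?B *v vector [- b, a] = inverse u *s vector [- b, a]"
      unfolding sum by simp_all
  qed
  have "det ?B = u * inverse u * (a * a + b * b)\<^sup>2"
    unfolding B by (simp add: det_2 power2_eq_square algebra_simps)
  then have det: "det ?A = 1" "det ?B = 1"
    using l' u' by (simp_all add: sum det_diag_mat)
  have "conj_transpose ?A = adj2 ?A"
    using norm by (simp add: mat2_eq_iff adj2_def diag_mat_def inverse_eq_cnj)
  moreover have "conj_transpose ?B = adj2 ?B"
    unfolding B using norm by (simp add: mat2_eq_iff adj2_def inverse_eq_cnj ab(5,6) algebra_simps)
  ultimately have SU2: "?A \<in> carrier SU2" "?B \<in> carrier SU2"
    using det by (simp_all add: SU2_iff)
  have "eval_word ?A ?B (replicate m (Gen_x, True)) = mat2 (l ^ m) 0 0 (l ^ m)"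
    by (rule eval_word_replicate_scalar[of _ _ _ "vector [1, 0]" _ "vector [0, 1]"])
      (use spectraD[OF lu] in \<open>simp_all add: diag_mat_eigen bracket_def\<close>)
  moreover have "eval_word ?A ?B (replicate n (Gen_y, True)) = mat2 (u ^ n) 0 0 (u ^ n)"
    by (rule eval_word_replicate_scalar[of _ _ _ "vector [a, b]" _ "vector [- b, a]"])
      (use spectraD[OF lu] in \<open>simp_all add: eigen bracket_def sum\<close>)
  ultimately have rel: "eval_word ?A ?B (replicate m (Gen_x, True)) = eval_word ?A ?B (replicate n (Gen_y, True))"
    using lu by (simp add: spectra_def)
  let ?\<rho> = "pair_rep ?A ?B"
  have hom: "?\<rho> \<in> hom (torus_knot_group m n) SU2"
    by (rule pair_rep_hom[OF SU2 rel])
  have xy: "?\<rho> (tk_x m n) = ?A" "?\<rho> (tk_y m n) = ?B"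
    unfolding tk_x_def tk_y_def pair_rep_word_class[OF det rel] by simp_all
  \<comment> \<open>Eigenvectors of \<open>?A\<close> lie on the axes since \<open>l\<close> differs
    from its inverse; the nonzero off-diagonal entries of \<open>?B\<close> move both axes.\<close>
  have "irreducible_pair ?A ?B"
    unfolding irreducible_pair_def
  proof clarify
    fix v c d assume v: "has_eigenvector ?A c v" "has_eigenvector ?B d v"
    have nz: "u - inverse u \<noteq> 0" "l - inverse l \<noteq> 0"
      using u' l' by simp_all
    have "v $ 1 = 0 \<or> l = c" "v $ 2 = 0 \<or> inverse l = c"
      using v(1) by (simp_all add: has_eigenvector_def diag_mat_def vec2_eq_iff mult2_vec_nth)
    then have "v $ 1 = 0 \<or> v $ 2 = 0"
      using l' by auto
    moreover have "a * b * (u - inverse u) * v $ 2 = 0" if "v $ 1 = 0"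
      using v(2) that by (auto simp: has_eigenvector_def B vec2_eq_iff mult2_vec_nth)
    moreover have "a * b * (u - inverse u) * v $ 1 = 0" if "v $ 2 = 0"
      using v(2) that by (auto simp: has_eigenvector_def B vec2_eq_iff mult2_vec_nth)
    ultimately have "v = 0"
      using nz ab by (auto simp: vec2_eq_iff)
    with v show False
      by (simp add: has_eigenvector_def)
  qed
  with hom have irr: "?\<rho> \<in> irred_SU2_reps m n"
    by (simp add: irred_SU2_reps_def xy)
  have "rep_character (torus_knot_group m n) ?\<rho> = curve_char m n ((l, u), s)"
    unfolding curve_char.simps
  proof (rule rep_character_intertwined[where P = "mat2 a 0 0 b"])
    show "?\<rho> \<in> hom (torus_knot_group m n) SL2C"
      using hom SU2_subset_SL2C by blast
    show "?\<rho> (tk_x m n) ** mat2 a 0 0 b = mat2 a 0 0 b ** diag_mat l"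
      unfolding xy by (simp add: mat2_eq_iff mult2_nth diag_mat_def)
    show "?\<rho> (tk_y m n) ** mat2 a 0 0 b = mat2 a 0 0 b ** norm_mat u s"
    proof -
      have M: "norm_mat u s = mat2 (a * a * u + b * b * inverse u) (b * b * (u - inverse u))
          (a * a * (u - inverse u)) (b * b * u + a * a * inverse u)"
        by (simp add: norm_mat_def ab)
      show ?thesis
        unfolding xy M unfolding B by (simp add: mat2_eq_iff mult2_nth algebra_simps)
    qed
  qed (use l' u' ab in \<open>simp_all add: det_diag_mat det_norm_mat det_mat2\<close>)
  with irr show ?thesis
    unfolding Y_irr_def by (metis imageI)
qed

lemma Y_irr_eq_curves:
  assumes "0 < m" "0 < n"
  shows "Y_irr m n = curve_char m n ` (spectra m n \<times> {0<..<1})"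
proof
  show "Y_irr m n \<subseteq> curve_char m n ` (spectra m n \<times> {0<..<1})"
  proof
    fix x assume "x \<in> Y_irr m n"
    then obtain \<rho> where "\<rho> \<in> irred_SU2_reps m n" "x = rep_character (torus_knot_group m n) \<rho>"
      unfolding Y_irr_def by blast
    with irred_SU2_rep_normal_form[OF assms] show "x \<in> curve_char m n ` (spectra m n \<times> {0<..<1})"
      by (metis SigmaI greaterThanLessThan_iff imageI)
  qed
  show "curve_char m n ` (spectra m n \<times> {0<..<1}) \<subseteq> Y_irr m n"
    using curve_char_in_Y_irr[OF assms] by auto
qed

section \<open>Counting the components\<close>

lemma cis_power_parity: "0 < k \<Longrightarrow> cis (pi * real a / real k) ^ k = (-1) ^ a"
proof -
  assume "0 < k"
  then have "cis (pi * real a / real k) ^ k = cis pi ^ a"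
    unfolding Complex.DeMoivre by (simp add: mult.commute)
  then show "cis (pi * real a / real k) ^ k = (-1) ^ a"
    unfolding cis_pi .
qed

lemma upper_root_of_unity_cis:
  assumes "0 < k" "l ^ k \<in> {1, -1}" "Im l > 0"
  obtains a where "0 < a" "a < k" "l = cis (pi * real a / real k)"
proof -
  define t where "t = Arg l"
  have t: "0 < t" "t < pi"
    using assms(3) Arg_lt_pi[of l] by (simp_all add: t_def)
  have "l \<noteq> 0" using assms(3) by auto
  then have l: "l = cis t"
    using cis_Arg[of l] norm_root_pm1[OF assms(1,2)] by (simp add: t_def sgn_eq)
  have "Im (l ^ k) = 0"
    using assms(2) by auto
  then have "sin (real k * t) = 0"
    unfolding l Complex.DeMoivre by simp
  then obtain i :: int where i: "real k * t = of_int i * pi"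
    by (auto simp: sin_zero_iff_int2)
  have "0 < of_int i * pi" "of_int i * pi < real k * pi"
    using t assms(1) by (simp_all flip: i)
  then have "0 < i" "i < int k"
    by (simp_all add: zero_less_mult_iff)
  moreover have "t = pi * of_int i / real k"
    using i assms(1) by (simp add: field_simps)
  ultimately show ?thesis
    by (intro that[of "nat i"]) (simp_all add: l)
qed

text \<open>In the upper half plane the solutions of \<open>l ^ m = \<plusminus>1\<close> are the
  points with angle \<open>pi a / m\<close> for \<open>0 < a < m\<close>, and then
  \<open>l ^ m = (-1) ^ a\<close>. Equality of the two powers is thus equality of parities.\<close>

lemma bij_betw_spectra:
  assumes "0 < m" "0 < n"
  shows "bij_betw (\<lambda>(a, b). (cis (pi * real a / real m), cis (pi * real b / real n)))
    {(a, b) \<in> {0<..<m} \<times> {0<..<n}. even a = even b} (spectra m n)"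
proof (rule bij_betw_imageI)
  have inj: "a = b" if "a \<in> {0<..<k}" "b \<in> {0<..<k}"
    "cis (pi * real a / real k) = cis (pi * real b / real k)" for a b k :: nat
  proof -
    have "cos (pi * real a / real k) = cos (pi * real b / real k)"
      using that(3) by (simp add: complex_eq_iff)
    then have "pi * real a / real k = pi * real b / real k"
      by (rule cos_inj_pi[rotated 4]) (use that in \<open>auto simp: field_simps\<close>)
    with that show ?thesis by simp
  qed
  show "inj_on (\<lambda>(a, b). (cis (pi * real a / real m), cis (pi * real b / real n)))
      {(a, b) \<in> {0<..<m} \<times> {0<..<n}. even a = even b}"
    by (auto intro!: inj_onI intro: inj)
  have Im: "Im (cis (pi * real a / real k)) > 0" if "a \<in> {0<..<k}" for a k :: nat
    using that by (simp, intro sin_gt_zero) (auto simp: field_simps)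
  show "(\<lambda>(a, b). (cis (pi * real a / real m), cis (pi * real b / real n))) `
      {(a, b) \<in> {0<..<m} \<times> {0<..<n}. even a = even b} = spectra m n" (is "?f ` ?S = _")
  proof
    show "?f ` ?S \<subseteq> spectra m n"
    proof -
      have "(cis (pi * real a / real m), cis (pi * real b / real n)) \<in> spectra m n"
        if "a \<in> {0<..<m}" "b \<in> {0<..<n}" "even a = even b" for a b
        using that Im[of a m] Im[of b n] assms
        by (simp add: spectra_def cis_power_parity minus_one_power_iff)
      then show ?thesis by auto
    qed
    show "spectra m n \<subseteq> ?f ` ?S"
    proof clarify
      fix l u assume lu: "(l, u) \<in> spectra m n"
      obtain a where a: "0 < a" "a < m" "l = cis (pi * real a / real m)"
        by (rule upper_root_of_unity_cis[OF assms(1) spectraD(2,4)[OF lu]])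
      obtain b where b: "0 < b" "b < n" "u = cis (pi * real b / real n)"
        by (rule upper_root_of_unity_cis[OF assms(2) spectraD(3,5)[OF lu]])
      have "even a = even b"
        using spectraD(1)[OF lu] assms
        by (auto simp: a b cis_power_parity minus_one_power_iff split: if_splits)
      with a b show "(l, u) \<in> ?f ` ?S"
        by (intro image_eqI[of _ _ "(a, b)"]) auto
    qed
  qed
qed

text \<open>Since \<open>m\<close> or \<open>n\<close> is odd, reflecting that coordinate exchanges equal and different parity.\<close>

lemma card_equal_parity:
  assumes "0 < m" "0 < n" "coprime m n"
  shows "card {(a, b) \<in> {0<..<m} \<times> {0<..<n}. even a = even b} = (m - 1) * (n - 1) div 2"
proof -
  let ?S = "{(a, b) \<in> {0<..<m} \<times> {0<..<n}. even a = even b}"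
  let ?D = "{(a, b) \<in> {0<..<m} \<times> {0<..<n}. even a \<noteq> even b}"
  have fin: "finite ?S" "finite ?D"
    by (rule finite_subset[of _ "{0<..<m} \<times> {0<..<n}"]; auto)+
  have "odd m \<or> odd n"
    using assms(3) by (metis coprime_common_divisor odd_one)
  then have "bij_betw (\<lambda>(a, b). (m - a, b)) ?S ?D \<or> bij_betw (\<lambda>(a, b). (a, n - b)) ?S ?D"
  proof
    assume "odd m"
    then have "bij_betw (\<lambda>(a, b). (m - a, b)) ?S ?D"
      by (intro bij_betwI[where g = "\<lambda>(a, b). (m - a, b)"]) auto
    then show ?thesis ..
  next
    assume "odd n"
    then have "bij_betw (\<lambda>(a, b). (a, n - b)) ?S ?D"
      by (intro bij_betwI[where g = "\<lambda>(a, b). (a, n - b)"]) auto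
    then show ?thesis ..
  qed
  then have "card ?S = card ?D"
    by (auto dest: bij_betw_same_card)
  moreover have "card ?S + card ?D = card (?S \<union> ?D)"
    by (rule card_Un_disjoint[symmetric]) (use fin in auto)
  moreover have "?S \<union> ?D = {0<..<m} \<times> {0<..<n}" by auto
  \<comment> \<open>Both parity classes have the same size and fill the rectangle, so the product is
    even and the integer division is exact.\<close>
  ultimately have "2 * card ?S = (m - 1) * (n - 1)"
    by (simp add: card_cartesian_product)
  then show ?thesis by simp
qed

lemma finite_spectra: "0 < m \<Longrightarrow> 0 < n \<Longrightarrow> finite (spectra m n)"
  by (rule bij_betw_finite[OF bij_betw_spectra, THEN iffD1])
    (auto intro: finite_subset[of _ "{0<..<m} \<times> {0<..<n}"])

lemma card_spectra:
  "0 < m \<Longrightarrow> 0 < n \<Longrightarrow> coprime m n \<Longrightarrow> card (spectra m n) = (m - 1) * (n - 1) div 2"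
  by (rule trans[OF bij_betw_same_card[OF bij_betw_spectra, symmetric] card_equal_parity])

section \<open>Atlases of the three spaces\<close>

lemma function_algebra_real_polynomial:
  "function_algebra {p :: 'a::real_normed_vector \<Rightarrow> real. real_polynomial_function p}"
  by standard auto

lemma topo_affine_subspace: "topo (subspace_of affine_space S) = top_of_set S"
  by (simp add: subspace_of_def affine_space_def)

lemma regular_affine_subspace:
  "regular (subspace_of affine_space S) = quotients_on S {p. real_polynomial_function p}"
  using function_algebra.quotients_on_quotients_on[OF function_algebra_real_polynomial, of S UNIV]
  by (simp add: subspace_of_def affine_space_def)

lemma continuous_map_real_polynomial:
  "real_polynomial_function p \<Longrightarrow> continuous_map (top_of_set S) euclideanreal p"
  by (simp add: continuous_at_imp_continuous_on continuous_real_polymonial_function)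

interpretation unit_rational: function_algebra unit_rational
  by (intro function_algebra.function_algebra_quotients function_algebra_poly)

lemma poly_unit_rational: "poly p \<in> unit_rational"
  using function_algebra.subset_quotients[OF function_algebra_poly] by blast

lemma real_polynomial_unit_rational:
  assumes "real_polynomial_function p"
    and "\<And>h. bounded_linear h \<Longrightarrow> (\<lambda>s. h (g s)) \<in> unit_rational"
  shows "(\<lambda>s. p (g s)) \<in> unit_rational"
  using assms(1)
  by (induction rule: real_polynomial_function.induct)
    (simp_all add: assms(2) unit_rational.const unit_rational.add unit_rational.mult)

text \<open>Polynomial functions are generated by bounded linear functionals, so rationality is only
  checked for these; a single fraction \<open>p / q\<close> recovers \<open>s\<close> on all curves
  at once.\<close>

lemma affine_curve_atlasI:
  fixes \<gamma> :: "'k \<times> real \<Rightarrow> 'a::euclidean_space"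
  assumes "finite K" and S: "S = \<gamma> ` (K \<times> {0<..<1})"
    and cont: "\<And>k. k \<in> K \<Longrightarrow> continuous_on {0<..<1} (\<lambda>s. \<gamma> (k, s))"
    and rat: "\<And>h k. k \<in> K \<Longrightarrow> bounded_linear h \<Longrightarrow> (\<lambda>s. h (\<gamma> (k, s))) \<in> unit_rational"
    and sep: "\<And>j k. j \<in> K \<Longrightarrow> k \<in> K \<Longrightarrow> j \<noteq> k \<Longrightarrow> \<exists>p :: 'a \<Rightarrow> real. bounded_linear p \<and>
      (\<exists>a b. a \<noteq> b \<and> (\<forall>s\<in>{0<..<1}. p (\<gamma> (j, s)) = a \<and> p (\<gamma> (k, s)) = b))"
    and coord: "real_polynomial_function p" "real_polynomial_function q" "\<And>x. x \<in> S \<Longrightarrow> q x \<noteq> 0"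
      "\<And>k s. k \<in> K \<Longrightarrow> 0 < s \<Longrightarrow> s < 1 \<Longrightarrow> p (\<gamma> (k, s)) = s * q (\<gamma> (k, s))"
  shows "curve_atlas (subspace_of affine_space S) K \<gamma>"
proof (rule curve_atlasI[where P = "{p. real_polynomial_function p}"])
  show "regular (subspace_of affine_space S) =
      quotients_on (topspace (topo (subspace_of affine_space S))) {p. real_polynomial_function p}"
    by (simp add: regular_affine_subspace topo_affine_subspace)
  show "topspace (topo (subspace_of affine_space S)) = \<gamma> ` (K \<times> {0<..<1})"
    by (simp add: topo_affine_subspace S)
  fix k assume k: "k \<in> K"
  show "continuous_map (top_of_set {0<..<1}) (topo (subspace_of affine_space S)) (\<lambda>s. \<gamma> (k, s))"
    using cont[OF k] k unfolding topo_affine_subspace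
    by (auto simp: continuous_map_in_subtopology S)
  show "\<exists>p\<in>{p. real_polynomial_function p}. \<exists>q\<in>{p. real_polynomial_function p}.
      (\<forall>x\<in>topspace (topo (subspace_of affine_space S)). q x \<noteq> 0) \<and>
      (\<forall>s\<in>{0<..<1}. p (\<gamma> (k, s)) = s * q (\<gamma> (k, s)))"
    using coord k by (intro bexI[of _ p] bexI[of _ q]) (auto simp: topo_affine_subspace)
next
  fix j k assume "j \<in> K" "k \<in> K" "j \<noteq> k"
  from sep[OF this] obtain p :: "'a \<Rightarrow> real" where "bounded_linear p"
    and p: "\<exists>a b. a \<noteq> b \<and> (\<forall>s\<in>{0<..<1}. p (\<gamma> (j, s)) = a \<and> p (\<gamma> (k, s)) = b)"
    by blast
  then have "p \<in> {p. real_polynomial_function p}"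
    by (simp add: real_polynomial_function.intros(1))
  with p show "\<exists>p\<in>{p. real_polynomial_function p}. \<exists>a b. a \<noteq> b \<and>
      (\<forall>s\<in>{0<..<1}. p (\<gamma> (j, s)) = a \<and> p (\<gamma> (k, s)) = b)"
    by (rule bexI)
next
  fix p :: "'a \<Rightarrow> real" and k assume "p \<in> {p. real_polynomial_function p}" "k \<in> K"
  then show "(\<lambda>s. p (\<gamma> (k, s))) \<in> unit_rational"
    using real_polynomial_unit_rational[of p "\<lambda>s. \<gamma> (k, s)"] rat by simp
next
  fix p :: "'a \<Rightarrow> real" assume "p \<in> {p. real_polynomial_function p}"
  then show "continuous_map (topo (subspace_of affine_space S)) euclideanreal p"
    unfolding topo_affine_subspace by (intro continuous_map_real_polynomial) simp
qed (use assms(1) function_algebra_real_polynomial in auto)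

lemma curve_atlas_interval_union:
  "curve_atlas (interval_union N) {..<N} (\<lambda>(k, s). (real k, s))"
  unfolding interval_union_def
proof (rule affine_curve_atlasI[where p = snd and q = "\<lambda>_. 1"])
  show "real ` {..<N} \<times> {0<..<1} = (\<lambda>(k, s). (real k, s)) ` ({..<N} \<times> {0<..<1})"
    by force
  fix h :: "real \<times> real \<Rightarrow> real" and k :: nat assume "bounded_linear h"
  then interpret bounded_linear h .
  have "h (real k, s) = poly [:h (real k, 0), h (0, 1):] s" for s :: real
    using add[of "(real k, 0)" "(0, s)"] scaleR[of s "(0, 1)"] by simp
  then have "(\<lambda>s. h (real k, s)) = poly [:h (real k, 0), h (0, 1):]"
    by (rule ext)
  then show "(\<lambda>s. h (case (k, s) of (k, s) \<Rightarrow> (real k, s))) \<in> unit_rational"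
    unfolding prod.case by (metis poly_unit_rational)
next
  fix j k :: nat assume "j \<noteq> k"
  then show "\<exists>p :: real \<times> real \<Rightarrow> real. bounded_linear p \<and> (\<exists>a b. a \<noteq> b \<and> (\<forall>s\<in>{0<..<1::real}.
      p (case (j, s) of (k, s) \<Rightarrow> (real k, s)) = a \<and> p (case (k, s) of (k, s) \<Rightarrow> (real k, s)) = b))"
    by (intro exI[of _ fst] conjI bounded_linear_fst exI[of _ "real j"] exI[of _ "real k"]) auto
qed (auto intro!: continuous_intros simp: bounded_linear_snd real_polynomial_function.intros(1)
      real_polynomial_function.intros(2))

text \<open>The value -1 stands for any negative \<open>r\<close>, since the parameter set restricts
  \<open>(l, u)\<close> and \<open>r\<close> independently. In contrast to \<open>spectra\<close>,
  every ordering of the eigenvalues occurs.\<close>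

definition full_spectra :: "nat \<Rightarrow> nat \<Rightarrow> (complex \<times> complex) set" where
  "full_spectra m n = {(l, u). (l, u, -1) \<in> param_set m n}"

lemma param_set_eq: "(l, u, r) \<in> param_set m n \<longleftrightarrow> (l, u) \<in> full_spectra m n \<and> r < 0"
  by (auto simp: full_spectra_def param_set_def)

lemma full_spectra_inverse:
  assumes "(l, u) \<in> full_spectra m n"
  shows "(inverse l, u) \<in> full_spectra m n" "(l, inverse u) \<in> full_spectra m n"
  using swap_param_set[of "(l, u, -1)" m n] assms by (simp_all add: full_spectra_def)

lemma full_spectraD:
  assumes "0 < m" "0 < n" "(l, u) \<in> full_spectra m n"
  shows "cmod l = 1" "cmod u = 1" "Im l \<noteq> 0" "Im u \<noteq> 0"
proof -
  have lu: "l ^ m \<in> {1, -1}" "u ^ n \<in> {1, -1}" "l \<notin> {1, -1}" "u \<notin> {1, -1}"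
    using assms(3) unfolding full_spectra_def param_set_def by auto
  then show norm: "cmod l = 1" "cmod u = 1"
    using norm_root_pm1 assms by blast+
  have "z \<in> {1, -1}" if "cmod z = 1" "Im z = 0" for z
    using cmod_eq_Re[OF that(2)] that by (auto simp: complex_eq_iff)
  with norm lu show "Im l \<noteq> 0" "Im u \<noteq> 0"
    by blast+
qed

lemma spectra_eq: "spectra m n = {(l, u) \<in> full_spectra m n. Im l > 0 \<and> Im u > 0}"
proof
  show "spectra m n \<subseteq> {(l, u) \<in> full_spectra m n. Im l > 0 \<and> Im u > 0}"
  proof (rule subrelI)
    fix l u assume lu: "(l, u) \<in> spectra m n"
    from spectra_param_set[OF this, of "1 / 2"] have "(l, u) \<in> full_spectra m n"
      by (simp add: full_spectra_def)
    with spectraD(4,5)[OF lu] show "(l, u) \<in> {(l, u) \<in> full_spectra m n. Im l > 0 \<and> Im u > 0}"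
      by simp
  qed
  show "{(l, u) \<in> full_spectra m n. Im l > 0 \<and> Im u > 0} \<subseteq> spectra m n"
    unfolding full_spectra_def param_set_def spectra_def by blast
qed

lemma finite_full_spectra:
  assumes mn: "0 < m" "0 < n"
  shows "finite (full_spectra m n)"
proof (rule finite_subset)
  let ?f = "\<lambda>(l :: complex, u :: complex). {(l, u), (inverse l, u), (l, inverse u), (inverse l, inverse u)}"
  show "full_spectra m n \<subseteq> (\<Union>k\<in>spectra m n. ?f k)"
  proof clarify
    fix l u assume lu: "(l, u) \<in> full_spectra m n"
    note D = full_spectraD[OF mn lu]
    have "\<exists>l'\<in>{l, inverse l}. \<exists>u'\<in>{u, inverse u}. (l', u') \<in> spectra m n"
      using D full_spectra_inverse[OF lu] full_spectra_inverse(2)[OF full_spectra_inverse(1)[OF lu]] lu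
      by (cases "Im l > 0"; cases "Im u > 0") (auto simp: spectra_eq inverse_eq_cnj)
    then obtain l' u' where "l' \<in> {l, inverse l}" "u' \<in> {u, inverse u}" "(l', u') \<in> spectra m n"
      by blast
    then show "(l, u) \<in> (\<Union>k\<in>spectra m n. ?f k)"
      by (intro UN_I[of "(l', u')"]) auto
  qed
  show "finite (\<Union>k\<in>spectra m n. ?f k)"
    using finite_spectra[OF mn] by auto
qed

fun param_curve :: "(complex \<times> complex) \<times> real \<Rightarrow> complex \<times> complex \<times> real" where
  "param_curve ((l, u), s) = (l, u, 1 - 1 / s)"

lemma curve_atlas_param_set:
  assumes mn: "0 < m" "0 < n"
  shows "curve_atlas (subspace_of affine_space (param_set m n)) (full_spectra m n)
    param_curve"
\<comment> \<open>Solving \<open>r = 1 - 1 / s\<close> gives \<open>s = 1 / (1 - r)\<close>, whose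
  denominator is positive for \<open>r < 0\<close>.\<close>
proof (rule affine_curve_atlasI[where p = "\<lambda>_. 1" and q = "\<lambda>x. 1 - snd (snd x)"])
  show "finite (full_spectra m n)"
    by (rule finite_full_spectra[OF mn])
  show "param_set m n = param_curve ` (full_spectra m n \<times> {0<..<1})" (is "_ = ?g ` _")
  proof
    show "param_set m n \<subseteq> ?g ` (full_spectra m n \<times> {0<..<1})"
    proof clarify
      fix l u r assume "(l, u, r) \<in> param_set m n"
      then show "(l, u, r) \<in> ?g ` (full_spectra m n \<times> {0<..<1})"
        by (intro image_eqI[of _ _ "((l, u), 1 / (1 - r))"]) (auto simp: param_set_eq)
    qed
  qed (auto simp: param_set_eq)
  have "bounded_linear (\<lambda>x :: complex \<times> complex \<times> real. snd (snd x))"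
    by (intro bounded_linear_compose[OF bounded_linear_snd] bounded_linear_snd)
  then have "real_polynomial_function (\<lambda>x :: complex \<times> complex \<times> real. snd (snd x))"
    by (rule real_polynomial_function.intros(1))
  then show "real_polynomial_function (\<lambda>x :: complex \<times> complex \<times> real. 1 - snd (snd x))"
    by (intro real_polynomial_function_diff real_polynomial_function.intros(2))
  show "real_polynomial_function (\<lambda>x :: complex \<times> complex \<times> real. 1)"
    by (rule real_polynomial_function.intros(2))
next
  fix k :: "complex \<times> complex" and h :: "complex \<times> complex \<times> real \<Rightarrow> real"
  assume "bounded_linear h"
  then interpret bounded_linear h .
  obtain l u where k: "k = (l, u)" by (cases k)
  have lin: "h (l, u, r) = h (l, u, 0) + r * h (0, 0, 1)" for r
    using add[of "(l, u, 0)" "(0, 0, r)"] scaleR[of r "(0, 0, 1)"] by simp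
  have "(\<lambda>s. h (l, u, 1 - 1 / s)) \<in> unit_rational"
  proof (rule quotients_onI)
    show "poly [:- h (0, 0, 1), h (l, u, 0) + h (0, 0, 1):] \<in> range poly" "poly [:0, 1:] \<in> range poly"
      by (rule rangeI)+
    fix s :: real assume "s \<in> {0<..<1}"
    then show "poly [:0, 1:] s \<noteq> 0"
        "h (l, u, 1 - 1 / s) = poly [:- h (0, 0, 1), h (l, u, 0) + h (0, 0, 1):] s / poly [:0, 1:] s"
      using lin[of "1 - 1 / s"] by (simp_all add: field_simps)
  qed
  then show "(\<lambda>s. h (param_curve (k, s))) \<in> unit_rational"
    by (simp add: k)
next
  fix j k :: "complex \<times> complex" assume "j \<noteq> k"
  obtain l u l' u' where jk: "j = (l, u)" "k = (l', u')" by (cases j, cases k)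
  have sep: "\<exists>p :: complex \<times> complex \<times> real \<Rightarrow> real. bounded_linear p \<and> (\<exists>a b. a \<noteq> b \<and> (\<forall>s\<in>{0<..<1}.
      p (param_curve (j, s)) = a \<and>
      p (param_curve (k, s)) = b))"
    if "bounded_linear q" "q (l, u) \<noteq> q (l', u')" for q :: "complex \<times> complex \<Rightarrow> real"
  proof (rule exI[of _ "\<lambda>x. q (fst x, fst (snd x))"], rule conjI)
    show "bounded_linear (\<lambda>x :: complex \<times> complex \<times> real. q (fst x, fst (snd x)))"
      by (intro bounded_linear_compose[OF that(1)] bounded_linear_Pair bounded_linear_fst
          bounded_linear_compose[OF bounded_linear_fst] bounded_linear_snd)
    show "\<exists>a b. a \<noteq> b \<and> (\<forall>s\<in>{0<..<1}. q (fst (param_curve (j, s)), fst (snd (param_curve (j, s)))) = a \<and>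
        q (fst (param_curve (k, s)), fst (snd (param_curve (k, s)))) = b)"
      by (rule exI[of _ "q (l, u)"], rule exI[of _ "q (l', u')"]) (simp add: jk that)
  qed
  have bl: "bounded_linear (\<lambda>x :: complex \<times> complex. Re (fst x))" "bounded_linear (\<lambda>x :: complex \<times> complex. Im (fst x))"
    "bounded_linear (\<lambda>x :: complex \<times> complex. Re (snd x))" "bounded_linear (\<lambda>x :: complex \<times> complex. Im (snd x))"
    by (intro bounded_linear_compose[OF bounded_linear_Re] bounded_linear_compose[OF bounded_linear_Im]
        bounded_linear_fst bounded_linear_snd)+
  have "Re l \<noteq> Re l' \<or> Im l \<noteq> Im l' \<or> Re u \<noteq> Re u' \<or> Im u \<noteq> Im u'"
    using \<open>j \<noteq> k\<close> unfolding jk by (auto simp: complex_eq_iff)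
  then show "\<exists>p :: complex \<times> complex \<times> real \<Rightarrow> real. bounded_linear p \<and> (\<exists>a b. a \<noteq> b \<and> (\<forall>s\<in>{0<..<1}.
      p (param_curve (j, s)) = a \<and>
      p (param_curve (k, s)) = b))"
    using sep[OF bl(1)] sep[OF bl(2)] sep[OF bl(3)] sep[OF bl(4)] by (elim disjE) simp_all
next
  fix x assume "x \<in> param_set m n"
  then show "1 - snd (snd x) \<noteq> 0"
    by (cases x) (auto simp: param_set_eq)
next
  fix k :: "complex \<times> complex" 
  obtain l u where k: "k = (l, u)" by (cases k)
  show "continuous_on {0<..<1} (\<lambda>s. param_curve (k, s))"
    unfolding k param_curve.simps by (intro continuous_intros) auto
  fix s :: real assume "0 < s" "s < 1"
  then show "1 = s * (1 - snd (snd (param_curve (k, s))))"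
    by (simp add: k)
qed

section \<open>Descent from the parameter set to its orbits\<close>

lemma orbit_swap:
  assumes "t \<in> param_set m n"
  shows "orbit Z2_Z2 (Z2_Z2_action m n) (swap_e t) = orbit Z2_Z2 (Z2_Z2_action m n) t"
    "orbit Z2_Z2 (Z2_Z2_action m n) (swap_f t) = orbit Z2_Z2 (Z2_Z2_action m n) t"
  using assms by (auto simp: orbit_param_set swap_param_set swap_commute)

lemma inverse_ratio: "s \<noteq> 0 \<Longrightarrow> s \<noteq> 1 \<Longrightarrow> inverse (1 - 1 / s) = 1 - 1 / (1 - s)" for s :: real
  by (simp add: field_simps)

lemma curve_param_inverse:
  assumes "(l, u) \<in> full_spectra m n" "0 < s" "s < 1"
  shows "curve_param m n ((inverse l, u), s) = curve_param m n ((l, u), 1 - s)"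
    "curve_param m n ((l, inverse u), s) = curve_param m n ((l, u), 1 - s)"
proof -
  have "(l, u, 1 - 1 / (1 - s)) \<in> param_set m n"
    using assms by (simp add: param_set_eq)
  from orbit_swap[OF this] inverse_ratio[of "1 - s"] assms
  show "curve_param m n ((inverse l, u), s) = curve_param m n ((l, u), 1 - s)"
    "curve_param m n ((l, inverse u), s) = curve_param m n ((l, u), 1 - s)"
    by simp_all
qed

text \<open>Each inversion needed to reach the upper half planes reflects the parameter once; two
  reflections cancel, which leaves two alternatives.\<close>

lemma curve_param_representative:
  assumes mn: "0 < m" "0 < n" and "k \<in> full_spectra m n"
  obtains k' where "k' \<in> spectra m n"
      "(\<forall>s\<in>{0<..<1}. curve_param m n (k, s) = curve_param m n (k', s)) \<or>
       (\<forall>s\<in>{0<..<1}. curve_param m n (k, s) = curve_param m n (k', 1 - s))"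
proof -
  obtain l u where k: "k = (l, u)" by (cases k)
  have lu: "(l, u) \<in> full_spectra m n" using assms(3) k by simp
  note D = full_spectraD[OF mn lu]
  note inv = full_spectra_inverse[OF lu]
  note inv2 = full_spectra_inverse(2)[OF inv(1)]
  consider "Im l > 0" "Im u > 0" | "Im l < 0" "Im u > 0" | "Im l > 0" "Im u < 0" | "Im l < 0" "Im u < 0"
    using D by linarith
  then show ?thesis
  proof cases
    case 1
    with lu show ?thesis
      by (intro that[of "(l, u)"]) (simp_all add: k spectra_eq)
  next
    case 2
    have "curve_param m n (k, s) = curve_param m n ((inverse l, u), 1 - s)" if "s \<in> {0<..<1}" for s
      using curve_param_inverse(1)[OF inv(1), of s] that by (simp add: k)
    with 2 inv D show ?thesis
      by (intro that[of "(inverse l, u)"]) (simp_all add: spectra_eq inverse_eq_cnj)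
  next
    case 3
    have "curve_param m n (k, s) = curve_param m n ((l, inverse u), 1 - s)" if "s \<in> {0<..<1}" for s
      using curve_param_inverse(2)[OF inv(2), of s] that by (simp add: k)
    with 3 inv D show ?thesis
      by (intro that[of "(l, inverse u)"]) (simp_all add: spectra_eq inverse_eq_cnj)
  next
    case 4
    have "curve_param m n (k, s) = curve_param m n ((inverse l, inverse u), s)" if "s \<in> {0<..<1}" for s
      using curve_param_inverse(1)[OF inv(1), of s] curve_param_inverse(2)[OF inv2, of "1 - s"] that
      by (simp add: k)
    with 4 inv2 D show ?thesis
      by (intro that[of "(inverse l, inverse u)"]) (simp_all add: spectra_eq inverse_eq_cnj)
  qed
qed

text \<open>Open sets and regular functions of the quotient are tested on all curves of the
  parameter set; the curves outside \<open>spectra\<close> repeat the conditions of their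
  representatives up to reflection.\<close>

lemma curve_atlas_param_quotient:
  assumes mn: "0 < m" "0 < n"
  shows "curve_atlas (param_quotient m n) (spectra m n) (curve_param m n)"
proof -
  let ?V = "subspace_of affine_space (param_set m n)" and ?p = "orbit Z2_Z2 (Z2_Z2_action m n)"
  let ?I = "{0<..<1::real}" and ?c = "curve_param m n"
  have V: "curve_atlas ?V (full_spectra m n) param_curve"
    by (rule curve_atlas_param_set[OF mn])
  have c: "?p (param_curve (k, s)) = ?c (k, s)" for k s
    by (cases k) simp
  have topV: "topspace (topo ?V) = param_set m n"
    by (simp add: topo_affine_subspace)
  have sub: "spectra m n \<subseteq> full_spectra m n"
    by (auto simp: spectra_eq)
  have "inj_on ?c (spectra m n \<times> ?I)"
  proof (rule inj_onI)
    fix x y assume xy: "x \<in> spectra m n \<times> ?I" "y \<in> spectra m n \<times> ?I" "?c x = ?c y"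
    obtain l u s l' u' s' where x: "x = ((l, u), s)" and y: "y = ((l', u'), s')"
      by (metis prod.exhaust)
    have lu: "(l, u) \<in> spectra m n" "(l', u') \<in> spectra m n" and s: "s \<in> ?I" "s' \<in> ?I"
      and eq: "?c ((l, u), s) = ?c ((l', u'), s')"
      using xy unfolding x y by auto
    have t: "(l, u, 1 - 1 / s) \<in> param_set m n" "(l', u', 1 - 1 / s') \<in> param_set m n"
      using spectra_param_set lu s by auto
    have "(l, u, 1 - 1 / s) \<in> ?c ((l', u'), s')"
      unfolding eq[symmetric] by (simp add: orbit_param_set[OF t(1)])
    \<comment> \<open>The other three orbit members invert \<open>l'\<close> or \<open>u'\<close>,
      which would put an eigenvalue in the lower half plane.\<close>
    then have "(l, u, 1 - 1 / s) = (l', u', 1 - 1 / s') \<or> u = inverse u' \<or> l = inverse l'"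
      by (auto simp: orbit_param_set[OF t(2)])
    moreover have "Im (inverse l') < 0" "Im (inverse u') < 0"
      using spectra_norm[OF mn lu(2)] spectraD[OF lu(2)] by (simp_all add: inverse_eq_cnj)
    ultimately show "x = y"
      unfolding x y using spectraD(4,5)[OF lu(1)] by auto
  qed
  moreover have top: "topspace (topo (param_quotient m n)) = ?c ` (spectra m n \<times> ?I)"
  proof -
    have "topspace (topo (param_quotient m n)) = ?p ` topspace (topo ?V)"
      unfolding topspace_param_quotient topV orbits_def by auto
    also have "\<dots> = ?c ` (full_spectra m n \<times> ?I)"
      unfolding curve_atlas_topspace[OF V] image_image by (rule image_cong[OF refl]) (auto simp: c)
    also have "\<dots> = ?c ` (spectra m n \<times> ?I)"
    proof
      show "?c ` (full_spectra m n \<times> ?I) \<subseteq> ?c ` (spectra m n \<times> ?I)"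
      proof (rule image_subsetI, clarify)
        fix l u s assume "(l, u) \<in> full_spectra m n" and s: "s \<in> ?I"
        then obtain k' where k': "k' \<in> spectra m n"
          and "?c ((l, u), s) = ?c (k', s) \<or> ?c ((l, u), s) = ?c (k', 1 - s)"
          by (metis curve_param_representative[OF mn])
        moreover have "1 - s \<in> ?I" using s by auto
        ultimately show "?c ((l, u), s) \<in> ?c ` (spectra m n \<times> ?I)"
          using s by (metis SigmaI imageI)
      qed
    qed (use sub in auto)
    finally show ?thesis .
  qed
  moreover have "openin (topo (param_quotient m n)) U \<longleftrightarrow>
      (\<forall>k\<in>spectra m n. open {s \<in> ?I. ?c (k, s) \<in> U})" if U: "U \<subseteq> topspace (topo (param_quotient m n))" for U
  proof -
    have "U \<subseteq> ?p ` topspace (topo ?V)"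
      using U unfolding topspace_param_quotient topV orbits_def by auto
    then have "openin (topo (param_quotient m n)) U \<longleftrightarrow>
        openin (topo ?V) {x \<in> topspace (topo ?V). ?p x \<in> U}"
      by (simp add: param_quotient_def quotient_space_def openin_quotient_topology)
    also have "\<dots> \<longleftrightarrow> (\<forall>k\<in>full_spectra m n. open {s \<in> ?I.
        param_curve (k, s) \<in> {x \<in> topspace (topo ?V). ?p x \<in> U}})"
      by (rule curve_atlas_openin[OF V]) blast
    also have "\<dots> \<longleftrightarrow> (\<forall>k\<in>full_spectra m n. open {s \<in> ?I. ?c (k, s) \<in> U})"
    proof (intro ball_cong refl arg_cong[where f = "open"] Collect_cong conj_cong)
      fix k s assume "k \<in> full_spectra m n" "s \<in> ?I"
      then have "param_curve (k, s) \<in> topspace (topo ?V)"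
        unfolding topV by (cases k) (simp add: param_set_eq)
      then show "param_curve (k, s) \<in> {x \<in> topspace (topo ?V). ?p x \<in> U} \<longleftrightarrow>
          ?c (k, s) \<in> U"
        using c[of k s] by simp
    qed
    also have "\<dots> \<longleftrightarrow> (\<forall>k\<in>spectra m n. open {s \<in> ?I. ?c (k, s) \<in> U})"
    proof
      assume op: "\<forall>k\<in>spectra m n. open {s \<in> ?I. ?c (k, s) \<in> U}"
      show "\<forall>k\<in>full_spectra m n. open {s \<in> ?I. ?c (k, s) \<in> U}"
      proof
        fix k assume "k \<in> full_spectra m n"
        then obtain k' where k': "k' \<in> spectra m n" and alt:
          "(\<forall>s\<in>?I. ?c (k, s) = ?c (k', s)) \<or> (\<forall>s\<in>?I. ?c (k, s) = ?c (k', 1 - s))"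
          by (rule curve_param_representative[OF mn])
        have op': "open {s \<in> ?I. ?c (k', s) \<in> U}"
          using op k' by blast
        have op'': "open ((\<lambda>s. 1 - s) -` {s \<in> ?I. ?c (k', s) \<in> U})"
          by (intro open_vimage[OF op'] continuous_intros)
        have "{s \<in> ?I. ?c (k, s) \<in> U} = {s \<in> ?I. ?c (k', s) \<in> U} \<or>
            {s \<in> ?I. ?c (k, s) \<in> U} = (\<lambda>s. 1 - s) -` {s \<in> ?I. ?c (k', s) \<in> U}"
          using alt by (rule disj_forward) auto
        then show "open {s \<in> ?I. ?c (k, s) \<in> U}"
          by (rule disjE) (simp_all only: op' op'')
      qed
    qed (use sub in blast)
    finally show ?thesis .
  qed
  moreover have "f \<in> regular (param_quotient m n) \<longleftrightarrow>
      (\<forall>k\<in>spectra m n. (\<lambda>s. f (?c (k, s))) \<in> unit_rational)" for f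
  proof -
    have "f \<in> regular (param_quotient m n) \<longleftrightarrow> f \<circ> ?p \<in> regular ?V"
      by (simp add: param_quotient_def quotient_space_def)
    also have "\<dots> \<longleftrightarrow> (\<forall>k\<in>full_spectra m n. (\<lambda>s. f (?c (k, s))) \<in> unit_rational)"
      unfolding curve_atlas_regular[OF V] comp_def c ..
    also have "\<dots> \<longleftrightarrow> (\<forall>k\<in>spectra m n. (\<lambda>s. f (?c (k, s))) \<in> unit_rational)"
    proof
      assume rat: "\<forall>k\<in>spectra m n. (\<lambda>s. f (?c (k, s))) \<in> unit_rational"
      show "\<forall>k\<in>full_spectra m n. (\<lambda>s. f (?c (k, s))) \<in> unit_rational"
      proof
        fix k assume "k \<in> full_spectra m n"
        then obtain k' where k': "k' \<in> spectra m n" and alt: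
          "(\<forall>s\<in>?I. ?c (k, s) = ?c (k', s)) \<or> (\<forall>s\<in>?I. ?c (k, s) = ?c (k', 1 - s))"
          by (rule curve_param_representative[OF mn])
        have rat': "(\<lambda>s. f (?c (k', s))) \<in> unit_rational"
          using rat k' by blast
        from alt show "(\<lambda>s. f (?c (k, s))) \<in> unit_rational"
        proof
          assume "\<forall>s\<in>?I. ?c (k, s) = ?c (k', s)"
          then show ?thesis
            using rat' by (subst unit_rational_cong[where g = "\<lambda>s. f (?c (k', s))"]) auto
        next
          assume "\<forall>s\<in>?I. ?c (k, s) = ?c (k', 1 - s)"
          then show ?thesis
            using unit_rational_reflect[OF rat']
            by (subst unit_rational_cong[where g = "\<lambda>s. f (?c (k', 1 - s))"]) auto
        qed
      qed
    qed (use sub in blast)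
    finally show ?thesis .
  qed
  ultimately show ?thesis
    unfolding curve_atlas_def by blast
qed

section \<open>Character values as polynomials in the curve parameter\<close>

definition complex_polys :: "(real \<Rightarrow> complex) set" where
  "complex_polys = range (\<lambda>p s. poly p (of_real s))"

lemma complex_polys_closed:
  "(\<lambda>_. c) \<in> complex_polys" "(\<lambda>s. of_real s) \<in> complex_polys"
  "f \<in> complex_polys \<Longrightarrow> g \<in> complex_polys \<Longrightarrow> (\<lambda>s. f s + g s) \<in> complex_polys"
  "f \<in> complex_polys \<Longrightarrow> g \<in> complex_polys \<Longrightarrow> (\<lambda>s. f s * g s) \<in> complex_polys"
proof -
  show "(\<lambda>_. c) \<in> complex_polys"
    unfolding complex_polys_def by (rule range_eqI[of _ _ "[:c:]"]) simp
  show "(\<lambda>s. of_real s) \<in> complex_polys"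
    unfolding complex_polys_def by (rule range_eqI[of _ _ "[:0, 1:]"]) simp
  assume "f \<in> complex_polys" "g \<in> complex_polys"
  then obtain p q where "f = (\<lambda>s. poly p (of_real s))" "g = (\<lambda>s. poly q (of_real s))"
    unfolding complex_polys_def by (elim rangeE)
  then show "(\<lambda>s. f s + g s) \<in> complex_polys" "(\<lambda>s. f s * g s) \<in> complex_polys"
    unfolding complex_polys_def
    by (auto intro: range_eqI[of _ _ "p + q"] range_eqI[of _ _ "p * q"])
qed

text \<open>For a real argument it suffices to take real and imaginary parts of the
  coefficients.\<close>

lemma complex_polys_Re_Im:
  assumes "f \<in> complex_polys"
  shows "(\<lambda>s. Re (f s)) \<in> range poly" "(\<lambda>s. Im (f s)) \<in> range poly"
proof -
  obtain p where f: "f = (\<lambda>s. poly p (of_real s))"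
    using assms unfolding complex_polys_def by blast
  have "\<exists>q r. \<forall>s. Re (poly p (of_real s)) = poly q s \<and> Im (poly p (of_real s)) = poly r s"
  proof (induction p)
    case (pCons a p)
    then obtain q r where "\<forall>s. Re (poly p (of_real s)) = poly q s \<and> Im (poly p (of_real s)) = poly r s"
      by blast
    then show ?case
      by (intro exI[of _ "pCons (Re a) q"] exI[of _ "pCons (Im a) r"]) simp
  qed (rule exI[of _ 0], rule exI[of _ 0], simp)
  then obtain q r where "\<And>s. Re (f s) = poly q s" "\<And>s. Im (f s) = poly r s"
    unfolding f by blast
  then show "(\<lambda>s. Re (f s)) \<in> range poly" "(\<lambda>s. Im (f s)) \<in> range poly"
    by auto
qed

text \<open>The entries of \<open>norm_mat u s\<close> are affine in \<open>s\<close>, and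
  \<open>adj2\<close> only permutes them and changes signs, so products over any word stay
  polynomial.\<close>

lemma eval_word_complex_polys:
  "(\<lambda>s. eval_word (diag_mat l) (norm_mat u s) w $ i $ j) \<in> complex_polys"
proof (induction w arbitrary: i j)
  case Nil
  show ?case by (simp add: complex_polys_closed)
next
  case (Cons c w)
  have minus: "(\<lambda>s. - f s) \<in> complex_polys" if "f \<in> complex_polys" for f
    using complex_polys_closed(4)[OF complex_polys_closed(1)[of "-1"] that] by simp
  have "(\<lambda>s. 1 + - of_real s) \<in> complex_polys"
    by (intro complex_polys_closed minus)
  then have diff: "(\<lambda>s. 1 - of_real s) \<in> complex_polys"
    by simp
  have entry: "(\<lambda>s. norm_mat u s $ i $ j) \<in> complex_polys" for i j
    using exhaust_2[of i] exhaust_2[of j] unfolding norm_mat_def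
    by (elim disjE; simp only: mat2_nth; intro complex_polys_closed diff)
  have adj: "(\<lambda>s. adj2 (norm_mat u s) $ i $ j) \<in> complex_polys" for i j
    using exhaust_2[of i] exhaust_2[of j] unfolding adj2_def
    by (elim disjE; simp only: mat2_nth; intro minus entry)
  have letter: "(\<lambda>s. eval_letter (diag_mat l) (norm_mat u s) c $ i $ j) \<in> complex_polys" for i j
  proof -
    obtain g b where "c = (g, b)" by (cases c)
    then show ?thesis
      by (cases g; cases b) (simp_all add: complex_polys_closed(1) entry adj)
  qed
  show ?case
    unfolding eval_word.simps mult2_nth by (intro complex_polys_closed letter Cons.IH)
qed

lemma norm_mat_relation:
  assumes "(l, u) \<in> spectra m n" and nz: "l \<noteq> 0" "u \<noteq> 0"
  shows "eval_word (diag_mat l) (norm_mat u s) (replicate m (Gen_x, True)) =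
    eval_word (diag_mat l) (norm_mat u s) (replicate n (Gen_y, True))"
proof -
  let ?E = "eval_word (diag_mat l) (norm_mat u s)"
  have "?E (replicate m (Gen_x, True)) = mat2 (l ^ m) 0 0 (l ^ m)"
    by (rule eval_word_replicate_scalar[of _ _ _ "vector [1, 0]" _ "vector [0, 1]"])
      (use spectraD[OF assms(1)] in \<open>simp_all add: diag_mat_eigen bracket_def\<close>)
  moreover have "?E (replicate n (Gen_y, True)) = mat2 (u ^ n) 0 0 (u ^ n)"
    by (rule eval_word_replicate_scalar[of _ _ _ "vector [1, 1]" _ "vector [of_real s - 1, of_real s]"])
      (use spectraD[OF assms(1)] in \<open>simp_all add: norm_mat_eigen bracket_def\<close>)
  ultimately show ?thesis
    using spectraD(1)[OF assms(1)] by simp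
qed

lemma curve_char_word_class:
  assumes "k \<in> spectra m n"
  shows "curve_char m n (k, s) (word_class (torus_rels m n) w) =
    trace (eval_word (diag_mat (fst k)) (norm_mat (snd k) s) w)"
proof -
  obtain l u where k: "k = (l, u)" by (cases k)
  have nz: "l \<noteq> 0" "u \<noteq> 0"
    using spectraD(4,5)[of l u m n] assms unfolding k by auto
  have "pair_rep (diag_mat l) (norm_mat u s) (word_class (torus_rels m n) w) =
      eval_word (diag_mat l) (norm_mat u s) w"
    using assms nz unfolding k
    by (intro pair_rep_word_class norm_mat_relation) (simp_all add: det_diag_mat det_norm_mat)
  then show ?thesis
    by (simp add: k rep_character_def carrier_torus_knot_group)
qed

lemma curve_char_complex_polys:
  assumes "k \<in> spectra m n" "g \<in> carrier (torus_knot_group m n)"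
  shows "(\<lambda>s. curve_char m n (k, s) g) \<in> complex_polys"
proof -
  obtain w where g: "g = word_class (torus_rels m n) w"
    using assms(2) unfolding carrier_torus_knot_group by blast
  show ?thesis
    unfolding g curve_char_word_class[OF assms(1)] trace_2
    by (intro complex_polys_closed eval_word_complex_polys)
qed

definition tk_xy :: "nat \<Rightarrow> nat \<Rightarrow> torus_gen gword set" where
  "tk_xy m n = word_class (torus_rels m n) [(Gen_x, True), (Gen_y, True)]"

text \<open>The trace of \<open>xy\<close> moves linearly along each component and serves as its coordinate.\<close>

lemma curve_char_generators:
  assumes mn: "0 < m" "0 < n" and lu: "(l, u) \<in> spectra m n"
  shows "Re (curve_char m n ((l, u), s) (tk_x m n)) = 2 * Re l"
    and "Re (curve_char m n ((l, u), s) (tk_y m n)) = 2 * Re u"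
    and "Re (curve_char m n ((l, u), s) (tk_xy m n)) = 2 * Re (l * cnj u) - s * (4 * (Im l * Im u))"
proof -
  have cnj: "inverse l = cnj l" "inverse u = cnj u"
    using spectra_norm[OF mn lu] by (simp_all add: inverse_eq_cnj)
  show "Re (curve_char m n ((l, u), s) (tk_x m n)) = 2 * Re l"
    "Re (curve_char m n ((l, u), s) (tk_y m n)) = 2 * Re u"
    "Re (curve_char m n ((l, u), s) (tk_xy m n)) = 2 * Re (l * cnj u) - s * (4 * (Im l * Im u))"
    \<comment> \<open>The coefficient of \<open>s\<close> in the trace of \<open>xy\<close> is the
      product of \<open>l - inverse l\<close> and \<open>u - inverse u\<close>; on the unit circle
      this is \<open>-4 * Im l * Im u\<close>.\<close>
    unfolding tk_x_def tk_y_def tk_xy_def curve_char_word_class[OF lu]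
    by (simp_all add: trace_2 mult2_nth diag_mat_def norm_mat_def cnj algebra_simps)
qed

lemma function_algebra_char_polynomials: "function_algebra (char_polynomials C)"
  by standard (auto intro: char_polynomials.intros)

lemma topspace_SL2_character_variety: "topspace (topo (SL2_character_variety G)) = SL2_characters G"
proof -
  have "SL2_characters G \<subseteq> extensional (carrier G)"
    by (auto simp: SL2_characters_def rep_character_def)
  then show ?thesis
    by (auto simp: SL2_character_variety_def PiE_def)
qed

text \<open>The traces of the two generators separate the components and the trace of
  \<open>xy\<close> recovers \<open>s\<close>. Since all character values are polynomial in
  \<open>s\<close> along a component, using every group element as a coordinate yields nothing
  beyond rational functions of \<open>s\<close>.\<close>

lemma curve_atlas_Y_irr:
  assumes mn: "0 < m" "0 < n"
  shows "curve_atlas (Y_irr_space m n) (spectra m n) (curve_char m n)"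
proof (rule curve_atlasI[where P = "char_polynomials (carrier (torus_knot_group m n))"])
  let ?G = "torus_knot_group m n" and ?V = "Y_irr_space m n"
  let ?P = "char_polynomials (carrier ?G)" and ?I = "{0<..<1::real}"
  have topo: "topo ?V = subtopology (product_topology (\<lambda>_. euclidean) (carrier ?G)) (Y_irr m n)"
    using Y_irr_subset[of m n]
    by (simp add: Y_irr_space_def subspace_of_def SL2_character_variety_def subtopology_subtopology Int_absorb1)
  have top: "topspace (topo ?V) = Y_irr m n"
    using Y_irr_subset[of m n]
    by (auto simp: Y_irr_space_def subspace_of_def topspace_SL2_character_variety)
  then show "topspace (topo ?V) = curve_char m n ` (spectra m n \<times> ?I)"
    by (simp add: Y_irr_eq_curves[OF mn])
  show "finite (spectra m n)"
    by (rule finite_spectra[OF mn])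
  show "function_algebra ?P"
    by (rule function_algebra_char_polynomials)
  show "regular ?V = quotients_on (topspace (topo ?V)) ?P"
    unfolding top using Y_irr_subset[of m n]
    by (simp add: Y_irr_space_def subspace_of_def topspace_SL2_character_variety Int_absorb1)
      (simp add: SL2_character_variety_def
        function_algebra.quotients_on_quotients_on[OF function_algebra_char_polynomials])
  have coordinate: "continuous_map (topo ?V) euclidean (\<lambda>x. x g)" if "g \<in> carrier ?G" for g
    unfolding topo
    by (intro continuous_map_from_subtopology continuous_map_product_projection that)
  show "continuous_map (topo ?V) euclideanreal p" if "p \<in> ?P" for p
    using that
  proof induction
    case (char_Re g)
    have "continuous_map euclidean euclideanreal Re"
      by (simp add: continuous_on_Re)
    from continuous_map_compose[OF coordinate[OF char_Re] this] show ?case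
      by (simp add: comp_def)
  next
    case (char_Im g)
    have "continuous_map euclidean euclideanreal Im"
      by (simp add: continuous_on_Im)
    from continuous_map_compose[OF coordinate[OF char_Im] this] show ?case
      by (simp add: comp_def)
  qed (auto intro: continuous_map_add continuous_map_real_mult)
  show "continuous_map (top_of_set ?I) (topo ?V) (\<lambda>s. curve_char m n (k, s))"
    if k: "k \<in> spectra m n" for k
    unfolding topo
  proof (rule continuous_map_into_subtopology)
    show "continuous_map (top_of_set ?I) (product_topology (\<lambda>_. euclidean) (carrier ?G))
        (\<lambda>s. curve_char m n (k, s))"
      unfolding continuous_map_componentwise
    proof (intro conjI ballI)
      show "(\<lambda>s. curve_char m n (k, s)) ` topspace (top_of_set ?I) \<subseteq> extensional (carrier ?G)"
        by (cases k) (auto simp: rep_character_def)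
      fix g assume "g \<in> carrier ?G"
      from curve_char_complex_polys[OF k this]
      obtain p where p: "(\<lambda>s. curve_char m n (k, s) g) = (\<lambda>s. poly p (of_real s))"
        unfolding complex_polys_def by (elim rangeE)
      have "continuous_on ?I (\<lambda>s. poly p (of_real s))"
        by (intro continuous_intros)
      then show "continuous_map (top_of_set ?I) euclidean (\<lambda>s. curve_char m n (k, s) g)"
        unfolding p by simp
    qed
    show "(\<lambda>s. curve_char m n (k, s)) \<in> topspace (top_of_set ?I) \<rightarrow> Y_irr m n"
      using k unfolding Y_irr_eq_curves[OF mn] by auto
  qed
  show "(\<lambda>s. p (curve_char m n (k, s))) \<in> unit_rational" if "p \<in> ?P" "k \<in> spectra m n" for p k
    using that(1)
  proof induction
    case (char_Re g)
    from complex_polys_Re_Im(1)[OF curve_char_complex_polys[OF that(2) this]] show ?case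
      using function_algebra.subset_quotients[OF function_algebra_poly] by blast
  next
    case (char_Im g)
    from complex_polys_Re_Im(2)[OF curve_char_complex_polys[OF that(2) this]] show ?case
      using function_algebra.subset_quotients[OF function_algebra_poly] by blast
  qed (simp_all add: unit_rational.const unit_rational.add unit_rational.mult)
  have tk: "tk_x m n \<in> carrier ?G" "tk_y m n \<in> carrier ?G" "tk_xy m n \<in> carrier ?G"
    by (simp_all add: carrier_torus_knot_group tk_x_def tk_y_def tk_xy_def)
  show "\<exists>p\<in>?P. \<exists>a b. a \<noteq> b \<and> (\<forall>s\<in>?I. p (curve_char m n (j, s)) = a \<and> p (curve_char m n (k, s)) = b)"
    if jk: "j \<in> spectra m n" "k \<in> spectra m n" "j \<noteq> k" for j k
  proof -
    obtain l u l' u' where j: "j = (l, u)" and k: "k = (l', u')" by (cases j, cases k)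
    have lu: "(l, u) \<in> spectra m n" "(l', u') \<in> spectra m n"
      using jk j k by auto
    note val = curve_char_generators[OF mn lu(1)] curve_char_generators[OF mn lu(2)]
    \<comment> \<open>A point of the upper unit semicircle is determined by its real part, which is
      half the trace of the generator.\<close>
    have upper: "z = w" if "cmod z = 1" "cmod w = 1" "Im z > 0" "Im w > 0" "Re z = Re w" for z w
    proof -
      have "(Im z)\<^sup>2 = (Im w)\<^sup>2"
        using that(1,2,5) cmod_power2[of z] cmod_power2[of w] by simp
      with that show ?thesis
        by (simp add: complex_eq_iff power2_eq_iff_nonneg)
    qed
    have "Re l \<noteq> Re l' \<or> Re u \<noteq> Re u'"
      using jk(3) upper[of l l'] upper[of u u'] spectra_norm[OF mn lu(1)] spectra_norm[OF mn lu(2)]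
        spectraD(4,5)[OF lu(1)] spectraD(4,5)[OF lu(2)] unfolding j k by auto
    then show ?thesis
    proof
      assume "Re l \<noteq> Re l'"
      then have "2 * Re l \<noteq> 2 * Re l' \<and> (\<forall>s\<in>?I. Re (curve_char m n (j, s) (tk_x m n)) = 2 * Re l \<and>
          Re (curve_char m n (k, s) (tk_x m n)) = 2 * Re l')"
        unfolding j k val by simp
      then show ?thesis
        by (intro bexI[OF _ char_polynomials.char_Re[OF tk(1)]] exI)
    next
      assume "Re u \<noteq> Re u'"
      then have "2 * Re u \<noteq> 2 * Re u' \<and> (\<forall>s\<in>?I. Re (curve_char m n (j, s) (tk_y m n)) = 2 * Re u \<and>
          Re (curve_char m n (k, s) (tk_y m n)) = 2 * Re u')"
        unfolding j k val by simp
      then show ?thesis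
        by (intro bexI[OF _ char_polynomials.char_Re[OF tk(2)]] exI)
    qed
  qed
  show "\<exists>p\<in>?P. \<exists>q\<in>?P. (\<forall>x\<in>topspace (topo ?V). q x \<noteq> 0) \<and>
      (\<forall>s\<in>?I. p (curve_char m n (k, s)) = s * q (curve_char m n (k, s)))" if "k \<in> spectra m n" for k
  proof -
    obtain l u where k: "k = (l, u)" by (cases k)
    have lu: "(l, u) \<in> spectra m n" using that k by simp
    let ?c = "4 * (Im l * Im u)"
    have p: "(\<lambda>x. 2 * Re (l * cnj u) + (-1) * Re (x (tk_xy m n))) \<in> ?P"
      by (intro char_polynomials.intros tk)
    have q: "(\<lambda>_. ?c) \<in> ?P"
      by (rule char_polynomials.intros)
    have "?c \<noteq> 0"
      using spectraD(4,5)[OF lu] by simp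
    moreover have "2 * Re (l * cnj u) + (-1) * Re (curve_char m n (k, s) (tk_xy m n)) = s * ?c" for s
      unfolding k curve_char_generators(3)[OF mn lu] by simp
    ultimately show ?thesis
      by (intro bexI[OF _ p] bexI[OF _ q]) blast
  qed
qed

section \<open>The isomorphisms\<close>

text \<open>The map reads off index and parameter and evaluates the other atlas there; injectivity
  of the first atlas gives it the prescribed values.\<close>

lemma atlas_isomorphism_exists:
  assumes V: "curve_atlas V K \<gamma>" and W: "curve_atlas W L \<delta>" and b: "bij_betw b K L"
  obtains \<phi> where "space_isomorphism V W \<phi>"
    "\<And>k s. k \<in> K \<Longrightarrow> 0 < s \<Longrightarrow> s < 1 \<Longrightarrow> \<phi> (\<gamma> (k, s)) = \<delta> (b k, s)"
proof -
  define \<phi> where "\<phi> x = (case inv_into (K \<times> {0<..<1}) \<gamma> x of (k, s) \<Rightarrow> \<delta> (b k, s))" for x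
  have \<phi>: "\<phi> (\<gamma> (k, s)) = \<delta> (b k, s)" if "k \<in> K" "0 < s" "s < 1" for k s
    unfolding \<phi>_def using that by (subst inv_into_f_f[OF curve_atlas_inj[OF V]]) auto
  show ?thesis
    by (rule that[OF space_isomorphism_atlas[OF V W b \<phi>] \<phi>])
qed

theorem proposition6:
  fixes m n :: nat
  assumes "0 < m" and "0 < n" and "coprime m n"
  shows "(\<exists>\<Phi>. space_isomorphism (Y_irr_space m n) (param_quotient m n) \<Phi> \<and>
            (\<forall>\<rho> \<in> irred_SU2_reps m n.
               \<Phi> (rep_character (torus_knot_group m n) \<rho>) =
               triples_of (\<rho> (tk_x m n)) (\<rho> (tk_y m n)))) \<and>
         (\<exists>\<Psi>. space_isomorphism (Y_irr_space m n)
                 (interval_union ((m - 1) * (n - 1) div 2)) \<Psi>)"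
proof
  note Y = curve_atlas_Y_irr[OF assms(1,2)]
  \<comment> \<open>Both atlases are indexed by \<open>spectra m n\<close>, so the index map is the
    identity and \<open>\<Phi>\<close> keeps the parameters that a character shares with its
    triples.\<close>
  obtain \<Phi> where \<Phi>: "space_isomorphism (Y_irr_space m n) (param_quotient m n) \<Phi>"
      "\<And>k s. k \<in> spectra m n \<Longrightarrow> 0 < s \<Longrightarrow> s < 1 \<Longrightarrow>
        \<Phi> (curve_char m n (k, s)) = curve_param m n (id k, s)"
    by (rule atlas_isomorphism_exists[OF Y curve_atlas_param_quotient[OF assms(1,2)] bij_betw_id]) (rule that)
  have "\<Phi> (rep_character (torus_knot_group m n) \<rho>) = triples_of (\<rho> (tk_x m n)) (\<rho> (tk_y m n))"
    if "\<rho> \<in> irred_SU2_reps m n" for \<rho>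
    by (rule irred_SU2_rep_normal_form[OF assms(1,2) that]) (simp only: \<Phi>(2) id_apply)
  with \<Phi>(1) show "\<exists>\<Phi>. space_isomorphism (Y_irr_space m n) (param_quotient m n) \<Phi> \<and>
      (\<forall>\<rho> \<in> irred_SU2_reps m n. \<Phi> (rep_character (torus_knot_group m n) \<rho>) =
        triples_of (\<rho> (tk_x m n)) (\<rho> (tk_y m n)))"
    by blast
  obtain b where "bij_betw b (spectra m n) {..<(m - 1) * (n - 1) div 2}"
    using ex_bij_betw_finite_nat[OF finite_spectra[OF assms(1,2)]]
    unfolding card_spectra[OF assms] lessThan_atLeast0 by blast
  then show "\<exists>\<Psi>. space_isomorphism (Y_irr_space m n) (interval_union ((m - 1) * (n - 1) div 2)) \<Psi>"
    using atlas_isomorphism_exists[OF Y curve_atlas_interval_union] by blast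
qed

end
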